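(* Let $n\ge 2$ be an integer and write $C=C_{W,n}(\mathbb{S}^n)=\left(\frac{n!}{2}\right)^{2/n}$. The eigenvalues $\lambda_k=\lambda_k(\mathbb{S}^n)$, $k=0,1,2,\dots$, of the Laplace-Beltrami operator on $\mathbb{S}^n$ satisfy $$\lambda_k(\mathbb{S}^n)\ \le\ C\,k^{2/n}+\sqrt{C}\,k^{1/n}\qquad\text{for all } k\ge 0,$$ and $$\lambda_k(\mathbb{S}^n)\ \ge\ C\,(k+1)^{2/n}-\sqrt{C}\,(k+1)^{1/n}-\left(\frac{n+1}{2}\right)^2-\frac{n^2}{\sqrt{C}\,(k+1)^{1/n}-n}\qquad\text{for all } k>\frac{2n^n}{n!}-1.$$ Both inequalities are asymptotically sharp: regarding the former, $$\frac{\lambda_k-C\,k^{2/n}}{\sqrt{C}\,k^{1/n}}\ \longrightarrow\ 1$$ along the subsequence $k=k_-(K)$, $K\to\infty$, of the lowest order eigenvalues of each chain, while for the latter $$\frac{C\,(k+1)^{2/n}-\lambda_k}{\sqrt{C}\,(k+1)^{1/n}}\ \longrightarrow\ 1$$ along the subsequence $k=k_+(K)$, $K\to\infty$, of the highest order eigenvalues of each chain.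
   Context: $\mathbb{S}^n=\{x\in\mathbb{R}^{n+1}:\|x\|=1\}$ carries the round metric; its (closed) eigenvalues ($\Delta u+\lambda u=0$), repeated according to multiplicity, are $0=\lambda_0\le\lambda_1\le\lambda_2\le\dots$ (indexing starts at $0$). The Weyl constant of an $n$-dimensional manifold $M$ is $C_{W,n}(M)=4\pi^2/(\omega_n|M|)^{2/n}$, where $\omega_n$ is the volume of the unit ball in $\mathbb{R}^n$ and $|M|$ the volume of $M$. Known facts and notation: the distinct eigenvalues of $\mathbb{S}^n$ are $\overline{\lambda}_K=K(K+n-1)$, $K=0,1,2,\dots$, with multiplicity $m(K)=\binom{n+K}{n}-\binom{n+K-2}{n}$ (a binomial $\binom{a}{b}$ with $a<b$ being $0$). Put $\sigma(K)=\sum_{i=0}^{K}m(i)$ and $\sigma(-1)=0$. The $K$-chain is the set of eigenvalues $\lambda_k$ with $k_-(K)\le k\le k_+(K)$, all equal to $\overline{\lambda}_K$, where $k_-(K)=\sigma(K-1)$ and $k_+(K)=\sigma(K)-1$ are its lowest and highest orders. *)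

theory Defs
  imports "HOL-Analysis.Analysis" "HOL-Library.Function_Algebras"
begin

text \<open>
  The sphere \<open>S\<^sup>n\<close> is \<open>sphere (0 :: 'a) 1\<close> for a Euclidean space \<open>'a\<close> with \<open>DIM('a) = n + 1\<close>. Its
  tangent space at \<open>x\<close> is \<open>{v. x \<bullet> v = 0}\<close>, and the round metric is the restriction of \<open>(\<bullet>)\<close>.
  Derivatives along the sphere are the library derivatives \<open>at x within sphere 0 1\<close>; such a
  derivative is determined on tangent vectors only.
\<close>

definition tangent_proj :: "'a::euclidean_space \<Rightarrow> 'a \<Rightarrow> 'a" where
  "tangent_proj x v = v - (x \<bullet> v) *\<^sub>R x"

definition sphere_grad :: "('a::euclidean_space \<Rightarrow> real) \<Rightarrow> 'a \<Rightarrow> 'a" where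
  "sphere_grad u x =
     (THE g. x \<bullet> g = 0 \<and> (u has_derivative (\<lambda>h. g \<bullet> h)) (at x within sphere 0 1))"

text \<open>
  The Levi-Civita connection of the sphere is the tangential part of the ambient derivative, so the
  divergence of a tangent field \<open>X\<close> is the trace over the tangent space of the derivative of \<open>X\<close>.
  The trace of a bilinear form \<open>\<beta>\<close> on the tangent space is the sum of
  \<open>\<beta> (tangent_proj x b) (tangent_proj x b)\<close> over an orthonormal basis of the ambient space.
\<close>

definition sphere_div :: "('a::euclidean_space \<Rightarrow> 'a) \<Rightarrow> 'a \<Rightarrow> real" where
  "sphere_div X x =
     (\<Sum>b\<in>Basis. frechet_derivative X (at x within sphere 0 1) (tangent_proj x b) \<bullet> tangent_proj x b)"

definition laplace_beltrami :: "('a::euclidean_space \<Rightarrow> real) \<Rightarrow> 'a \<Rightarrow> real" where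
  "laplace_beltrami u = sphere_div (sphere_grad u)"

definition sphere_C1 :: "('a::euclidean_space \<Rightarrow> 'b::real_normed_vector) \<Rightarrow> bool" where
  "sphere_C1 f \<longleftrightarrow>
     (\<exists>D. (\<forall>x\<in>sphere 0 1. (f has_derivative D x) (at x within sphere 0 1)) \<and>
          (\<forall>h. continuous_on (sphere 0 1) (\<lambda>x. D x h)))"

definition sphere_C2 :: "('a::euclidean_space \<Rightarrow> real) \<Rightarrow> bool" where
  "sphere_C2 u \<longleftrightarrow> sphere_C1 u \<and> sphere_C1 (sphere_grad u)"

text \<open>
  Functions on the sphere are represented by functions on the ambient space that vanish off the
  sphere, so that linear independence of eigenfunctions has its usual meaning.
\<close>

definition eigenspace :: "real \<Rightarrow> ('a::euclidean_space \<Rightarrow> real) set" where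
  "eigenspace \<mu> =
     {u. sphere_C2 u \<and> (\<forall>x\<in>sphere 0 1. laplace_beltrami u x + \<mu> * u x = 0) \<and>
         (\<forall>x. x \<notin> sphere 0 1 \<longrightarrow> u x = 0)}"

global_interpretation fun_space: vector_space "\<lambda>(c::real) (f::'a \<Rightarrow> real) x. c * f x"
  by unfold_locales (auto simp: fun_eq_iff algebra_simps)

text \<open>
  \<open>l\<close> lists the eigenvalues in nondecreasing order, each one as often as its multiplicity, i.e. the
  indices with value \<open>\<mu>\<close> are equinumerous with a basis of the eigenspace of \<open>\<mu>\<close>. Real numbers
  that are not eigenvalues have the empty basis and do not occur.
\<close>

definition is_eigenvalue_sequence :: "'a::euclidean_space itself \<Rightarrow> (nat \<Rightarrow> real) \<Rightarrow> bool" where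
  "is_eigenvalue_sequence _ l \<longleftrightarrow>
     mono l \<and>
     (\<forall>\<mu>. \<exists>B :: ('a \<Rightarrow> real) set. fun_space.independent B \<and> fun_space.span B = eigenspace \<mu> \<and>
           (\<exists>f. bij_betw f {k. l k = \<mu>} B))"

definition sphere_eigenvalue :: "'a::euclidean_space itself \<Rightarrow> nat \<Rightarrow> real" where
  "sphere_eigenvalue T = (THE l. is_eigenvalue_sequence T l)"

text \<open>
  Minkowski content in codimension one; for a compact smooth hypersurface this is its Riemannian
  volume.
\<close>

definition hypersurface_volume :: "'a::euclidean_space set \<Rightarrow> real" where
  "hypersurface_volume M =
     Lim (at_right 0) (\<lambda>\<epsilon>. measure lebesgue {x. infdist x M \<le> \<epsilon>} / (2 * \<epsilon>))"

text \<open>The arguments are the dimension and the volume of the manifold.\<close>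

definition weyl_constant :: "nat \<Rightarrow> real \<Rightarrow> real" where
  "weyl_constant n V = 4 * pi\<^sup>2 / (unit_ball_vol (real n) * V) powr (2 / real n)"

text \<open>
  The term \<open>n + K - 2\<close> is truncated subtraction, which is exact for \<open>n \<ge> 2\<close>.
\<close>

definition chain_mult :: "nat \<Rightarrow> nat \<Rightarrow> nat" where
  "chain_mult n K = ((n + K) choose n) - ((n + K - 2) choose n)"

text \<open>\<open>chain_sum n K\<close> is the sum of the multiplicities with index strictly below \<open>K\<close>.\<close>

definition chain_sum :: "nat \<Rightarrow> nat \<Rightarrow> nat" where
  "chain_sum n K = (\<Sum>i<K. chain_mult n i)"

definition k_minus :: "nat \<Rightarrow> nat \<Rightarrow> nat" where
  "k_minus n K = chain_sum n K"

definition k_plus :: "nat \<Rightarrow> nat \<Rightarrow> nat" where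
  "k_plus n K = chain_sum n (Suc K) - 1"

end

theory Submission
  imports Defs
begin

text \<open>
  \<^emph>\<open>Spectrum.\<close> Write \<open>\<Delta>\<close> for the Laplace-Beltrami operator and \<open>V K\<close> for the restrictions to the
  sphere of the polynomials of degree below \<open>K\<close>. The Laplacian of a monomial of degree \<open>K\<close> shows that
  \<open>\<Delta> + K (K + n - 1)\<close> maps \<open>V (K + 1)\<close> into \<open>V K\<close>, on which it is invertible because the numbers
  \<open>K (K + n - 1)\<close> are distinct. Hence \<open>V (K + 1)\<close> is the direct sum of \<open>V K\<close> and the eigenfunctions it
  contains, and counting monomials gives the multiplicities. There are no further eigenfunctions:
  \<open>\<Delta>\<close> is symmetric for an inner product given by an integral, so a remaining eigenfunction would be
  orthogonal to all polynomials, and hence zero by Stone-Weierstrass. Instead of surface measure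
  the inner product uses the Lebesgue integral of the radial extension times a bump function.

  \<^emph>\<open>Bounds.\<close> If \<open>x = sqrt C * k powr (1 / n)\<close> for the lowest order \<open>k\<close> of the \<open>K\<close>-chain, then
  \<open>x ^ n = K (K + 1) \<dots> (K + n - 2) (K + n / 2 - 1)\<close>. Pairing opposite factors gives
  \<open>K (K + n - 2) \<le> x\<^sup>2 \<le> (K + n / 2 - 1)\<^sup>2\<close> and \<open>K \<le> x\<close>, so that \<open>K (K + n - 1) \<le> x\<^sup>2 + x\<close>. The highest
  order of the chain is one less than the lowest order of the next.
\<close>

section \<open>Calculus on the sphere\<close>

text \<open>\<open>sphere_eigenvalue\<close> is a definite description, so it has a usable value
  only once the eigenspace of every real number is known exactly. This is why completeness must be
  proved, and not just the existence of polynomial eigenfunctions. An eigenfunction for K (K + n -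
  1) is first projected onto the finite-dimensional space of polynomial eigenfunctions with that
  value; the remainder is orthogonal to these by construction and to all others by symmetry. The
  sphere has empty interior, so a derivative \<open>at x within sphere 0 1\<close> is fixed on
  tangent vectors only; the calculus lemmas accept any derivative and evaluate it tangentially. A
  radial extension is singular at the origin. The bump function lives on the shell 1 < norm y < 2,
  which avoids the origin and lets all boundary terms vanish on a large box. In the bounds, the
  factor K + n / 2 - 1 is exactly the midpoint of the other n - 1 factors. Hence x^2 exceeds K (K +
  n - 2) by at most (n / 2 - 1)^2, and this one estimate yields both inequalities and both
  limits.\<close>

lemma sphere_derivative_unique:
  fixes f :: "'a::euclidean_space \<Rightarrow> 'b::real_normed_vector"
  assumes x: "norm x = 1" and xv: "x \<bullet> v = 0"
    and D: "(f has_derivative D) (at x within sphere 0 1)"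
    and D': "(f has_derivative D') (at x within sphere 0 1)"
  shows "D v = D' v"
proof (cases "v = 0")
  case True
  then show ?thesis
    using has_derivative_linear[OF D] has_derivative_linear[OF D'] by (simp add: linear_0)
next
  case False
  define w where "w = v /\<^sub>R norm v"
  have w: "norm w = 1" "x \<bullet> w = 0" "v = norm v *\<^sub>R w"
    using False xv by (auto simp: w_def)
  \<comment> \<open>The great circle through \<open>x\<close> with velocity \<open>w\<close>. It
    stays on the sphere, so \<open>D\<close> and \<open>D'\<close> both give the derivative of
    \<open>f \<circ> \<gamma>\<close> at 0, and derivatives of functions of a real variable are
    unique.\<close>
  define \<gamma> where "\<gamma> t = cos t *\<^sub>R x + sin t *\<^sub>R w" for t :: real
  have xx: "x \<bullet> x = 1" "w \<bullet> w = 1" "w \<bullet> x = 0"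
    using x w by (auto simp: norm_eq_1 inner_commute)
  have \<gamma>S: "\<gamma> t \<in> sphere 0 1" for t
  proof -
    have "\<gamma> t \<bullet> \<gamma> t = (cos t)\<^sup>2 + (sin t)\<^sup>2"
      using xx w(2) by (simp add: \<gamma>_def inner_add_left inner_add_right power2_eq_square)
    then show ?thesis by (simp add: norm_eq_1)
  qed
  have \<gamma>0: "\<gamma> 0 = x" by (simp add: \<gamma>_def)
  have d\<gamma>: "(\<gamma> has_derivative (\<lambda>t. t *\<^sub>R w)) (at 0)"
    unfolding \<gamma>_def by (auto intro!: derivative_eq_intros)
  have *: "((f \<circ> \<gamma>) has_derivative E \<circ> (\<lambda>t. t *\<^sub>R w)) (at 0)"
    if "(f has_derivative E) (at x within sphere 0 1)" for E
  proof -
    have "(f has_derivative E) (at (\<gamma> 0) within range \<gamma>)"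
      unfolding \<gamma>0 by (rule has_derivative_subset[OF that]) (use \<gamma>S in auto)
    then show ?thesis using diff_chain_within[OF d\<gamma>] by simp
  qed
  have "D \<circ> (\<lambda>t. t *\<^sub>R w) = D' \<circ> (\<lambda>t. t *\<^sub>R w)"
    using *[OF D] *[OF D'] by (rule has_derivative_unique)
  from fun_cong[OF this, of "norm v"] show ?thesis using w(3) by simp
qed

lemma inner_tangent_proj:
  "norm x = 1 \<Longrightarrow> x \<bullet> tangent_proj x v = 0"
  by (simp add: tangent_proj_def inner_diff_right norm_eq_1)

lemma tangent_proj_self: "norm x = 1 \<Longrightarrow> tangent_proj x x = 0"
  by (simp add: tangent_proj_def norm_eq_1)

lemma bounded_linear_tangent_proj: "bounded_linear (tangent_proj x)"
  unfolding tangent_proj_def by (intro bounded_linear_intros)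

text \<open>The normal component of a derivative may be discarded because \<open>x \<bullet> y = 1 - dist y x ^ 2 / 2\<close>
  for \<open>y\<close> on the sphere.\<close>

lemma has_derivative_tangent_proj:
  fixes f :: "'a::euclidean_space \<Rightarrow> 'b::real_normed_vector"
  assumes x: "norm x = 1" and D: "(f has_derivative D) (at x within sphere 0 1)"
  shows "(f has_derivative (\<lambda>h. D (tangent_proj x h))) (at x within sphere 0 1)"
proof -
  interpret D: bounded_linear D using D by (rule has_derivative_bounded_linear)
  have "((\<lambda>y. 1 - (y - x) \<bullet> (y - x) / 2) has_derivative (\<lambda>h. 0)) (at x within sphere 0 1)"
    by (auto intro!: derivative_eq_intros)
  then have 0: "((\<lambda>y. x \<bullet> y) has_derivative (\<lambda>h. 0)) (at x within sphere 0 1)"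
  proof (rule has_derivative_transform[rotated -1])
    fix y :: 'a assume "y \<in> sphere 0 1"
    then show "x \<bullet> y = 1 - (y - x) \<bullet> (y - x) / 2"
      using x by (simp add: norm_eq_1 inner_diff_left inner_diff_right inner_commute field_simps)
  qed (use x in auto)
  \<comment> \<open>Subtracting and adding the same term: the subtracted copy is differentiated in
    the obvious way, the added copy by \<open>0\<close>. The difference of the two derivatives is
    the normal part of \<open>D\<close>.\<close>
  have "((\<lambda>y. (f y - (x \<bullet> y) *\<^sub>R D x) + (x \<bullet> y) *\<^sub>R D x) has_derivative
      (\<lambda>h. (D h - (x \<bullet> h) *\<^sub>R D x) + 0 *\<^sub>R D x)) (at x within sphere 0 1)"
    by (intro has_derivative_add has_derivative_diff D has_derivative_scaleR_left
        has_derivative_inner_right has_derivative_ident 0)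
  then show ?thesis
    by (simp add: tangent_proj_def D.diff D.scaleR)
qed

text \<open>Resolves the description in \<open>sphere_grad\<close> from any derivative
  \<open>D\<close>, whatever its value on the normal: by the previous lemma \<open>D\<close> may be
  precomposed with the projection. Uniqueness follows by testing two candidates against their
  difference, which is tangent.\<close>

lemma sphere_grad_eqI:
  fixes u :: "'a::euclidean_space \<Rightarrow> real"
  assumes x: "norm x = 1" and D: "(u has_derivative D) (at x within sphere 0 1)"
    and g: "x \<bullet> g = 0" "\<And>h. x \<bullet> h = 0 \<Longrightarrow> D h = g \<bullet> h"
  shows "sphere_grad u x = g" and "(u has_derivative (\<lambda>h. g \<bullet> h)) (at x within sphere 0 1)"
proof -
  have "D (tangent_proj x h) = g \<bullet> h" for h
    using g inner_tangent_proj[OF x, of h]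
    by (simp add: tangent_proj_def inner_diff_right inner_commute)
  then show d: "(u has_derivative (\<lambda>h. g \<bullet> h)) (at x within sphere 0 1)"
    using has_derivative_tangent_proj[OF x D] by simp
  show "sphere_grad u x = g"
    unfolding sphere_grad_def
  proof (rule the_equality)
    fix g' assume g': "x \<bullet> g' = 0 \<and> (u has_derivative (\<lambda>h. g' \<bullet> h)) (at x within sphere 0 1)"
    have "g' \<bullet> (g' - g) = g \<bullet> (g' - g)"
      by (rule sphere_derivative_unique[OF x]) (use g g' d in \<open>auto simp: inner_diff_right\<close>)
    then have "(g' - g) \<bullet> (g' - g) = 0" by (simp add: inner_diff_left)
    then show "g' = g" by simp
  qed (use g d in auto)
qed

lemma linear_functional_eq_inner:
  fixes D :: "'a::euclidean_space \<Rightarrow> real"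
  assumes "linear D"
  shows "D h = (\<Sum>b\<in>Basis. D b *\<^sub>R b) \<bullet> h"
proof -
  have "D h = D (\<Sum>b\<in>Basis. (h \<bullet> b) *\<^sub>R b)" by (simp add: euclidean_representation)
  also have "\<dots> = (\<Sum>b\<in>Basis. D b *\<^sub>R b) \<bullet> h"
    by (simp only: linear_sum[OF assms] linear_scale[OF assms] inner_sum_left)
      (simp add: inner_commute mult.commute)
  finally show ?thesis .
qed

lemma sphere_C1E:
  assumes "sphere_C1 f"
  obtains D where "\<And>x. norm x = 1 \<Longrightarrow> (f has_derivative D x) (at x within sphere 0 1)"
    "\<And>h. continuous_on (sphere 0 1) (\<lambda>x. D x h)"
proof -
  obtain D where "(\<forall>x\<in>sphere 0 1. (f has_derivative D x) (at x within sphere 0 1)) \<and>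
          (\<forall>h. continuous_on (sphere 0 1) (\<lambda>x. D x h))"
    using assms unfolding sphere_C1_def ..
  then show ?thesis by (intro that[of D]) (simp_all add: mem_sphere_0)
qed

lemma sphere_grad_deriv:
  fixes u :: "'a::euclidean_space \<Rightarrow> real"
  assumes u: "sphere_C1 u" and x: "norm x = 1"
  shows "x \<bullet> sphere_grad u x = 0"
    and "(u has_derivative (\<lambda>h. sphere_grad u x \<bullet> h)) (at x within sphere 0 1)"
proof -
  obtain D where D: "(u has_derivative D) (at x within sphere 0 1)"
    using sphere_C1E[OF u] x by metis
  define g where "g = tangent_proj x (\<Sum>b\<in>Basis. D b *\<^sub>R b)"
  have g: "x \<bullet> g = 0" unfolding g_def by (rule inner_tangent_proj[OF x])
  have "D h = g \<bullet> h" if "x \<bullet> h = 0" for h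
    using that linear_functional_eq_inner[OF has_derivative_linear[OF D], of h]
    by (simp add: g_def tangent_proj_def inner_diff_left)
  from sphere_grad_eqI[OF x D g this]
  show "x \<bullet> sphere_grad u x = 0"
    and "(u has_derivative (\<lambda>h. sphere_grad u x \<bullet> h)) (at x within sphere 0 1)"
    using g by auto
qed

text \<open>\<open>frechet_derivative\<close> picks one of many derivatives within the sphere; since
  \<open>sphere_div\<close> evaluates it on tangent vectors only, any derivative gives the same
  value.\<close>

lemma sphere_div_eq:
  fixes X :: "'a::euclidean_space \<Rightarrow> 'a"
  assumes x: "norm x = 1" and D: "(X has_derivative D) (at x within sphere 0 1)"
  shows "sphere_div X x = (\<Sum>b\<in>Basis. D (tangent_proj x b) \<bullet> tangent_proj x b)"
proof -
  have "(X has_derivative frechet_derivative X (at x within sphere 0 1)) (at x within sphere 0 1)"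
    using D by (auto simp: differentiable_def frechet_derivative_works[symmetric])
  from sphere_derivative_unique[OF x _ this D] inner_tangent_proj[OF x] show ?thesis
    unfolding sphere_div_def by simp
qed

lemma has_derivative_sphere_cong:
  assumes "(f has_derivative D) (at x within sphere 0 1)" "\<And>x. norm x = 1 \<Longrightarrow> f x = g x" "norm x = 1"
  shows "(g has_derivative D) (at x within sphere 0 1)"
  using assms by (intro has_derivative_transform[OF _ _ assms(1)]) auto

lemma sphere_C1_cong:
  assumes "sphere_C1 f" "\<And>x. norm x = 1 \<Longrightarrow> f x = g x"
  shows "sphere_C1 g"
proof -
  obtain D where D: "\<And>x. norm x = 1 \<Longrightarrow> (f has_derivative D x) (at x within sphere 0 1)"
    "\<And>h. continuous_on (sphere 0 1) (\<lambda>x. D x h)"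
    using sphere_C1E[OF assms(1)] by blast
  show ?thesis unfolding sphere_C1_def
    by (intro exI[of _ D]) (use D has_derivative_sphere_cong[OF D(1) assms(2)] in auto)
qed

lemma sphere_C1_continuous: "sphere_C1 f \<Longrightarrow> continuous_on (sphere 0 1) f"
  by (erule sphere_C1E) (meson continuous_on_eq_continuous_within has_derivative_continuous mem_sphere_0)

lemma sphere_C1_add: "sphere_C1 f \<Longrightarrow> sphere_C1 g \<Longrightarrow> sphere_C1 (\<lambda>x. f x + g x)"
  unfolding sphere_C1_def
proof (elim exE conjE)
  fix D E
  assume "\<forall>x\<in>sphere 0 1. (f has_derivative D x) (at x within sphere 0 1)"
    "\<forall>h. continuous_on (sphere 0 1) (\<lambda>x. D x h)"
    "\<forall>x\<in>sphere 0 1. (g has_derivative E x) (at x within sphere 0 1)"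
    "\<forall>h. continuous_on (sphere 0 1) (\<lambda>x. E x h)"
  then show "\<exists>D. (\<forall>x\<in>sphere 0 1. ((\<lambda>x. f x + g x) has_derivative D x) (at x within sphere 0 1)) \<and>
      (\<forall>h. continuous_on (sphere 0 1) (\<lambda>x. D x h))"
    by (intro exI[of _ "\<lambda>x h. D x h + E x h"]) (auto intro!: derivative_intros continuous_intros)
qed

lemma sphere_C1_scaleR:
  fixes f :: "'a::euclidean_space \<Rightarrow> real" and g :: "'a \<Rightarrow> 'b::real_normed_vector"
  assumes "sphere_C1 f" "sphere_C1 g"
  shows "sphere_C1 (\<lambda>x. f x *\<^sub>R g x)"
proof -
  note c = sphere_C1_continuous[OF assms(1)] sphere_C1_continuous[OF assms(2)]
  obtain D E where
    "\<forall>x\<in>sphere 0 1. (f has_derivative D x) (at x within sphere 0 1)"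
    "\<forall>h. continuous_on (sphere 0 1) (\<lambda>x. D x h)"
    "\<forall>x\<in>sphere 0 1. (g has_derivative E x) (at x within sphere 0 1)"
    "\<forall>h. continuous_on (sphere 0 1) (\<lambda>x. E x h)"
    using assms unfolding sphere_C1_def by blast
  with c show ?thesis unfolding sphere_C1_def
    by (intro exI[of _ "\<lambda>x h. f x *\<^sub>R E x h + D x h *\<^sub>R g x"])
      (auto intro!: derivative_intros continuous_intros)
qed

lemma sphere_C1_const: "sphere_C1 (\<lambda>x. c)"
  unfolding sphere_C1_def by (intro exI[of _ "\<lambda>x h. 0"]) auto

lemma sphere_grad_linear:
  assumes "sphere_C1 u" "sphere_C1 v" "norm x = 1"
  shows "sphere_grad (\<lambda>y. c * u y + d * v y) x = c *\<^sub>R sphere_grad u x + d *\<^sub>R sphere_grad v x"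
  by (rule sphere_grad_eqI(1)[where D = "\<lambda>h. c * (sphere_grad u x \<bullet> h) + d * (sphere_grad v x \<bullet> h)"])
    (use assms sphere_grad_deriv[OF assms(1,3)] sphere_grad_deriv[OF assms(2,3)] in
      \<open>auto intro!: derivative_intros simp: inner_add_left inner_add_right\<close>)

lemma sphere_div_cong:
  assumes "sphere_C1 X" "\<And>x. norm x = 1 \<Longrightarrow> X x = Y x" "norm x = 1"
  shows "sphere_div Y x = sphere_div X x"
proof -
  obtain D where D: "(X has_derivative D) (at x within sphere 0 1)"
    using sphere_C1E[OF assms(1)] assms(3) by metis
  then have "(Y has_derivative D) (at x within sphere 0 1)"
    by (rule has_derivative_sphere_cong) (use assms in auto)
  with D show ?thesis using assms(3) by (simp add: sphere_div_eq)
qed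

lemma sphere_div_linear:
  assumes "sphere_C1 X" "sphere_C1 Y" "norm x = 1"
  shows "sphere_div (\<lambda>y. c *\<^sub>R X y + d *\<^sub>R Y y) x = c * sphere_div X x + d * sphere_div Y x"
proof -
  obtain D where D: "(X has_derivative D) (at x within sphere 0 1)"
    using sphere_C1E[OF assms(1)] assms(3) by metis
  obtain E where E: "(Y has_derivative E) (at x within sphere 0 1)"
    using sphere_C1E[OF assms(2)] assms(3) by metis
  have "((\<lambda>y. c *\<^sub>R X y + d *\<^sub>R Y y) has_derivative (\<lambda>h. c *\<^sub>R D h + d *\<^sub>R E h)) (at x within sphere 0 1)"
    by (intro derivative_intros D E)
  from sphere_div_eq[OF assms(3) this] sphere_div_eq[OF assms(3) D] sphere_div_eq[OF assms(3) E]
  show ?thesis by (simp add: inner_add_left sum.distrib sum_distrib_left)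
qed

text \<open>The projected basis vectors form a Parseval frame of the tangent space. As
  \<open>g\<close> is tangent, its pairing ignores the projection; what remains is Parseval's
  identity and a correction with the factor \<open>g \<bullet> x = 0\<close>.\<close>

lemma sum_inner_tangent_proj:
  assumes "norm (x::'a::euclidean_space) = 1" "x \<bullet> g = 0"
  shows "(\<Sum>b\<in>Basis. (g \<bullet> tangent_proj x b) * (h \<bullet> tangent_proj x b)) = g \<bullet> h"
proof -
  have *: "g \<bullet> tangent_proj x b = g \<bullet> b" for b
    using assms by (simp add: tangent_proj_def inner_diff_right inner_commute)
  have "(\<Sum>b\<in>Basis. (g \<bullet> tangent_proj x b) * (h \<bullet> tangent_proj x b))
      = (\<Sum>b\<in>Basis. (g \<bullet> b) * (h \<bullet> b)) - (h \<bullet> x) * (\<Sum>b\<in>Basis. (g \<bullet> b) * (x \<bullet> b))"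
    unfolding * by (simp add: tangent_proj_def inner_diff_right algebra_simps sum_subtractf sum_distrib_left)
  also have "\<dots> = g \<bullet> h - (h \<bullet> x) * (g \<bullet> x)"
    by (simp only: euclidean_inner[symmetric])
  finally show ?thesis using assms by (simp add: inner_commute)
qed

lemma sphere_div_scaleR:
  fixes u :: "'a::euclidean_space \<Rightarrow> real"
  assumes u: "sphere_C1 u" and X: "sphere_C1 X" and x: "norm x = 1"
  shows "sphere_div (\<lambda>y. u y *\<^sub>R X y) x = u x * sphere_div X x + sphere_grad u x \<bullet> X x"
proof -
  obtain D where D: "(X has_derivative D) (at x within sphere 0 1)"
    using sphere_C1E[OF X] x by metis
  note g = sphere_grad_deriv[OF u x]
  have "((\<lambda>y. u y *\<^sub>R X y) has_derivative (\<lambda>h. u x *\<^sub>R D h + (sphere_grad u x \<bullet> h) *\<^sub>R X x))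
      (at x within sphere 0 1)"
    by (intro derivative_intros D g)
  from sphere_div_eq[OF x this] sphere_div_eq[OF x D] sum_inner_tangent_proj[OF x g(1), of "X x"]
  show ?thesis by (simp add: inner_add_left sum.distrib sum_distrib_left)
qed

text \<open>All notions depend on the values on the sphere only. This permits computing with ambient
  polynomials and then cutting them off outside the sphere, as \<open>eigenspace\<close>
  demands.\<close>

lemma sphere_C2_cong:
  assumes "sphere_C2 u" "\<And>x. norm x = 1 \<Longrightarrow> u x = v x"
  shows "sphere_C2 v" and "\<And>x. norm x = 1 \<Longrightarrow> sphere_grad v x = sphere_grad u x"
    and "\<And>x. norm x = 1 \<Longrightarrow> laplace_beltrami v x = laplace_beltrami u x"
proof -
  have u: "sphere_C1 u" "sphere_C1 (sphere_grad u)" using assms unfolding sphere_C2_def by auto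
  have v: "sphere_C1 v" using u(1) assms(2) by (rule sphere_C1_cong)
  show g: "sphere_grad v x = sphere_grad u x" if x: "norm x = 1" for x
  proof (rule sphere_grad_eqI(1)[OF x])
    show "(v has_derivative (\<lambda>h. sphere_grad u x \<bullet> h)) (at x within sphere 0 1)"
      by (rule has_derivative_sphere_cong[OF sphere_grad_deriv(2)[OF u(1) x]]) (use x assms in auto)
  qed (use sphere_grad_deriv[OF u(1) x] in auto)
  have "sphere_C1 (sphere_grad v)" using u(2) by (rule sphere_C1_cong) (simp add: g)
  with v show "sphere_C2 v" by (simp add: sphere_C2_def)
  show "laplace_beltrami v x = laplace_beltrami u x" if "norm x = 1" for x
    unfolding laplace_beltrami_def by (rule sphere_div_cong) (use u g that in auto)
qed

lemma sphere_C2_linear: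
  assumes "sphere_C2 u" "sphere_C2 v"
  shows "sphere_C2 (\<lambda>y. c * u y + d * v y)"
    and "\<And>x. norm x = 1 \<Longrightarrow>
      laplace_beltrami (\<lambda>y. c * u y + d * v y) x = c * laplace_beltrami u x + d * laplace_beltrami v x"
proof -
  have C: "sphere_C1 u" "sphere_C1 v" "sphere_C1 (sphere_grad u)" "sphere_C1 (sphere_grad v)"
    using assms by (auto simp: sphere_C2_def)
  have 1: "sphere_C1 (\<lambda>y. c *\<^sub>R sphere_grad u y + d *\<^sub>R sphere_grad v y)"
    by (intro sphere_C1_add sphere_C1_scaleR sphere_C1_const C)
  have "sphere_C1 (\<lambda>y. c *\<^sub>R u y + d *\<^sub>R v y)"
    by (intro sphere_C1_add sphere_C1_scaleR sphere_C1_const C)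
  moreover have "sphere_C1 (sphere_grad (\<lambda>y. c * u y + d * v y))"
    using 1 by (rule sphere_C1_cong) (simp add: sphere_grad_linear C)
  ultimately show "sphere_C2 (\<lambda>y. c * u y + d * v y)" by (simp add: sphere_C2_def)
  fix x :: 'a assume x: "norm x = 1"
  show "laplace_beltrami (\<lambda>y. c * u y + d * v y) x = c * laplace_beltrami u x + d * laplace_beltrami v x"
    unfolding laplace_beltrami_def
    by (subst sphere_div_linear[OF C(3,4) x, symmetric], rule sphere_div_cong[OF 1])
      (use C x in \<open>auto simp: sphere_grad_linear\<close>)
qed

section \<open>Tangential traces and the Laplacian of ambient functions\<close>

text \<open>Expanding both projections yields two mixed sums and one normal term, each equal to
  \<open>x \<bullet> A x\<close> up to sign; together they remove the normal direction from the
  trace once.\<close>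

lemma tangent_trace:
  fixes x :: "'a::euclidean_space"
  assumes x: "norm x = 1" and A: "linear A"
  shows "(\<Sum>b\<in>Basis. A (tangent_proj x b) \<bullet> tangent_proj x b) = (\<Sum>b\<in>Basis. A b \<bullet> b) - x \<bullet> A x"
proof -
  have "(\<Sum>b\<in>Basis. A (tangent_proj x b) \<bullet> tangent_proj x b)
     = (\<Sum>b\<in>Basis. A b \<bullet> b - (x \<bullet> b) * (A x \<bullet> b) - (x \<bullet> b) * (A b \<bullet> x) + (x \<bullet> A x) * ((x \<bullet> b) * (x \<bullet> b)))"
    by (rule sum.cong) (simp_all add: tangent_proj_def linear_diff[OF A] linear_scale[OF A]
        inner_diff_left inner_diff_right inner_commute algebra_simps)
  also have "\<dots> = (\<Sum>b\<in>Basis. A b \<bullet> b) - x \<bullet> A x - (\<Sum>b\<in>Basis. (x \<bullet> b) * (A b \<bullet> x)) + x \<bullet> A x"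
    using x by (simp add: sum.distrib sum_subtractf sum_distrib_left[symmetric] euclidean_inner[of x, symmetric] norm_eq_1)
  also have "(\<Sum>b\<in>Basis. (x \<bullet> b) * (A b \<bullet> x)) = A (\<Sum>b\<in>Basis. (x \<bullet> b) *\<^sub>R b) \<bullet> x"
    by (simp add: linear_sum[OF A] linear_scale[OF A] inner_sum_left)
  also have "\<dots> = x \<bullet> A x" by (subst euclidean_representation) (rule inner_commute)
  finally show ?thesis by simp
qed

text \<open>The outer projection contributes \<open>D (tangent_proj x x) \<bullet> x\<close>, which
  is 0. Without it the sum has the shape of a Euclidean divergence, as required for the comparison
  with the radial extension.\<close>

lemma sphere_div_tangent:
  fixes X :: "'a::euclidean_space \<Rightarrow> 'a"
  assumes x: "norm x = 1" and D: "(X has_derivative D) (at x within sphere 0 1)"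
  shows "sphere_div X x = (\<Sum>b\<in>Basis. D (tangent_proj x b) \<bullet> b)"
proof -
  interpret D: bounded_linear D using D by (rule has_derivative_bounded_linear)
  have "(\<Sum>b\<in>Basis. D (tangent_proj x b) \<bullet> (x \<bullet> b) *\<^sub>R x)
      = D (tangent_proj x (\<Sum>b\<in>Basis. (x \<bullet> b) *\<^sub>R b)) \<bullet> x"
  proof -
    interpret P: bounded_linear "tangent_proj x" by (rule bounded_linear_tangent_proj)
    show ?thesis by (simp add: P.sum P.scaleR D.sum D.scaleR inner_sum_left)
  qed
  also have "\<dots> = 0" by (simp add: euclidean_representation tangent_proj_self[OF x] D.zero)
  finally have 0: "(\<Sum>b\<in>Basis. D (tangent_proj x b) \<bullet> (x \<bullet> b) *\<^sub>R x) = 0" .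
  have "sphere_div X x = (\<Sum>b\<in>Basis. D (tangent_proj x b) \<bullet> (b - (x \<bullet> b) *\<^sub>R x))"
    unfolding sphere_div_eq[OF x D] by (simp add: tangent_proj_def)
  also have "\<dots> = (\<Sum>b\<in>Basis. D (tangent_proj x b) \<bullet> b)"
    using 0 by (simp add: inner_diff_right sum_subtractf)
  finally show ?thesis .
qed

text \<open>The classical formula: Euclidean Laplacian minus second radial derivative minus (N - 1)
  times the radial derivative, for ambient gradient \<open>G\<close> and Hessian \<open>H\<close>.
  The last term is the trace of the derivative of the normal part
  \<open>(x \<bullet> G x) *\<^sub>R x\<close> that is removed from the gradient.\<close>

lemma laplace_beltrami_ambient:
  fixes f :: "'a::euclidean_space \<Rightarrow> real"
  assumes G: "\<And>x. (f has_derivative (\<lambda>h. G x \<bullet> h)) (at x)"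
    and H: "\<And>x. (G has_derivative H x) (at x)"
    and cont: "\<And>h. continuous_on UNIV (\<lambda>x. H x h)"
  shows "sphere_C2 f"
    and "norm x = 1 \<Longrightarrow> laplace_beltrami f x =
      (\<Sum>b\<in>Basis. H x b \<bullet> b) - x \<bullet> H x x - (real (DIM('a)) - 1) * (x \<bullet> G x)"
proof -
  have Gc: "continuous_on A G" for A
    using H by (meson continuous_at_imp_continuous_on has_derivative_continuous)
  have Hc: "continuous_on A (\<lambda>x. H x h)" for A h
    using cont continuous_on_subset by blast
  have C1f: "sphere_C1 f" unfolding sphere_C1_def
    by (intro exI[of _ "\<lambda>x h. G x \<bullet> h"]) (auto intro!: has_derivative_at_withinI G continuous_intros Gc)
  have grad: "sphere_grad f x = G x - (x \<bullet> G x) *\<^sub>R x" if x: "norm x = 1" for x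
    by (rule sphere_grad_eqI(1)[OF x has_derivative_at_withinI[OF G]])
      (use x in \<open>auto simp: inner_diff_left inner_diff_right norm_eq_1\<close>)
  define H' where "H' x h = H x h - ((x \<bullet> G x) *\<^sub>R h + (h \<bullet> G x + x \<bullet> H x h) *\<^sub>R x)" for x h
  have d': "((\<lambda>x. G x - (x \<bullet> G x) *\<^sub>R x) has_derivative H' x) (at x within A)" for x A
    unfolding H'_def
    by (auto intro!: derivative_eq_intros has_derivative_at_withinI[OF H] simp: fun_eq_iff)
  have C1g: "sphere_C1 (\<lambda>x. G x - (x \<bullet> G x) *\<^sub>R x)"
    unfolding sphere_C1_def
    by (intro exI[of _ H'] conjI ballI allI d') (auto simp: H'_def intro!: continuous_intros Gc Hc)
  have "sphere_C1 (sphere_grad f)" using C1g by (rule sphere_C1_cong) (simp add: grad)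
  with C1f show "sphere_C2 f" by (simp add: sphere_C2_def)
  assume x: "norm x = 1"
  have lin: "linear (H x)" using H by (rule has_derivative_linear)
  let ?P = "tangent_proj x"
  have "laplace_beltrami f x = sphere_div (\<lambda>x. G x - (x \<bullet> G x) *\<^sub>R x) x"
    unfolding laplace_beltrami_def by (rule sphere_div_cong) (use C1g x in \<open>auto simp: grad\<close>)
  also have "\<dots> = (\<Sum>b\<in>Basis. H' x (?P b) \<bullet> ?P b)"
    by (rule sphere_div_eq[OF x d'])
  also have "\<dots> = (\<Sum>b\<in>Basis. H x (?P b) \<bullet> ?P b - (x \<bullet> G x) * (?P b \<bullet> ?P b))"
    by (rule sum.cong) (simp_all add: H'_def inner_diff_left inner_add_left inner_tangent_proj[OF x])
  also have "\<dots> = (\<Sum>b\<in>Basis. H x b \<bullet> b) - x \<bullet> H x x - (x \<bullet> G x) * (real (DIM('a)) - 1)"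
    using tangent_trace[OF x lin] tangent_trace[OF x linear_ident] x
    by (simp add: sum_subtractf sum_distrib_left[symmetric] norm_eq_1)
  finally show "laplace_beltrami f x =
      (\<Sum>b\<in>Basis. H x b \<bullet> b) - x \<bullet> H x x - (real (DIM('a)) - 1) * (x \<bullet> G x)" by simp
qed

section \<open>Integration over the sphere\<close>

text \<open>Translation invariance: the integral of \<open>h\<close> shifted by \<open>t\<close>
  along \<open>b\<close> is constant for small \<open>t\<close>, and differentiating under the
  integral sign gives the claim. The box reaches to 4, so a support of radius 2 shifted by less than
  1 stays inside it.\<close>

lemma integral_partial_derivative_eq_0:
  fixes h :: "'a::euclidean_space \<Rightarrow> real"
  assumes d: "\<And>y. (h has_derivative h' y) (at y)"
    and cont: "continuous_on UNIV (\<lambda>y. h' y b)"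
    and supp: "\<And>y. norm y > 2 \<Longrightarrow> h y = 0"
    and b: "norm b = 1"
  shows "integral (cbox (-4 *\<^sub>R One) (4 *\<^sub>R One)) (\<lambda>y. h' y b) = 0"
proof -
  let ?Q = "cbox (-4 *\<^sub>R One) (4 *\<^sub>R One) :: 'a set"
  have out: "norm y > 4" if "y \<notin> ?Q" for y :: 'a
  proof -
    from that obtain i where "i \<in> Basis" "\<not> (-4 \<le> y \<bullet> i \<and> y \<bullet> i \<le> 4)"
      by (auto simp: mem_box)
    then show ?thesis using Basis_le_norm[of i y] by linarith
  qed
  have hc: "continuous_on A h" for A
    using d by (meson continuous_at_imp_continuous_on has_derivative_continuous)
  have shc: "continuous_on A (\<lambda>y. h (y + t *\<^sub>R b))" for A t
    by (rule continuous_on_compose2[OF hc[of UNIV]]) (auto intro!: continuous_intros)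
  define G where "G t = integral ?Q (\<lambda>y. h (y + t *\<^sub>R b))" for t :: real
  have Gt: "G t = G 0" if t: "\<bar>t\<bar> < 1" for t
  proof -
    have z: "h (y + t *\<^sub>R b) = 0" if "y \<notin> ?Q" for y
    proof (rule supp)
      have "norm y \<le> norm (y + t *\<^sub>R b) + norm (t *\<^sub>R b)"
        by (metis add_diff_cancel_right' norm_triangle_ineq4)
      then show "norm (y + t *\<^sub>R b) > 2" using t b out[OF that] by simp
    qed
    have "((\<lambda>y. h (y + t *\<^sub>R b)) has_integral G t) ?Q"
      unfolding G_def by (intro integrable_integral integrable_continuous shc)
    then have 1: "((\<lambda>y. h (y + t *\<^sub>R b)) has_integral G t) UNIV"
      by (rule has_integral_on_superset) (use z in auto)
    have "(h has_integral G 0) ?Q"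
      unfolding G_def by (simp, intro integrable_integral integrable_continuous hc)
    from has_integral_affinity[OF this, of 1 "t *\<^sub>R b"]
    have "((\<lambda>y. h (y + t *\<^sub>R b)) has_integral G 0) ((\<lambda>x. x - t *\<^sub>R b) ` ?Q)"
      by simp
    then have 2: "((\<lambda>y. h (y + t *\<^sub>R b)) has_integral G 0) UNIV"
    proof (rule has_integral_on_superset)
      fix y assume "y \<notin> (\<lambda>x. x - t *\<^sub>R b) ` ?Q"
      then have "y + t *\<^sub>R b \<notin> ?Q" by (metis add_diff_cancel_right' image_eqI)
      from out[OF this] show "h (y + t *\<^sub>R b) = 0" by (intro supp) simp
    qed auto
    show ?thesis using has_integral_unique[OF 1 2] .
  qed
  have dG: "(G has_field_derivative integral ?Q (\<lambda>y. h' (y + 0 *\<^sub>R b) b)) (at 0 within UNIV)"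
    unfolding G_def
  proof (rule leibniz_rule_field_derivative)
    fix t :: real and y :: 'a
    have lin: "linear (h' z)" for z using d by (rule has_derivative_linear)
    have "((\<lambda>t. h (y + t *\<^sub>R b)) has_derivative (\<lambda>s. h' (y + t *\<^sub>R b) (s *\<^sub>R b))) (at t)"
      by (rule has_derivative_compose[OF _ d]) (auto intro!: derivative_eq_intros)
    then show "((\<lambda>t. h (y + t *\<^sub>R b)) has_field_derivative h' (y + t *\<^sub>R b) b) (at t)"
      by (simp add: has_field_derivative_def linear_scale[OF lin] mult.commute[of _ "h' _ _"])
  next
    have "continuous_on (UNIV \<times> ?Q) (\<lambda>p. h' (snd p + fst p *\<^sub>R b) b)"
      by (rule continuous_on_compose2[OF cont]) (auto intro!: continuous_intros)
    then show "continuous_on (UNIV \<times> ?Q) (\<lambda>(t, y). h' (y + t *\<^sub>R b) b)"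
      by (simp add: case_prod_beta)
  qed (auto intro!: integrable_continuous shc)
  have "integral ?Q (\<lambda>y. h' (y + 0 *\<^sub>R b) b) = 0"
    by (rule DERIV_local_const[OF dG zero_less_one], intro allI impI, rule Gt[symmetric]) simp
  then show ?thesis by simp
qed

section \<open>A radial cutoff and the extension of functions from the sphere\<close>

text \<open>A cutoff supported on [1, 4], meant for the argument \<open>y \<bullet> y\<close>, hence
  living on the shell between the radii 1 and 2. Squaring the positive part makes it continuously
  differentiable, which suffices for the divergence theorem.\<close>

definition bump :: "real \<Rightarrow> real" where
  "bump s = (max 0 ((s - 1) * (4 - s)))\<^sup>2"

definition bump' :: "real \<Rightarrow> real" where
  "bump' s = 2 * max 0 ((s - 1) * (4 - s)) * (5 - 2 * s)"

lemma DERIV_max_0_power2: "((\<lambda>t::real. (max 0 t)\<^sup>2) has_real_derivative 2 * max 0 t) (at t)"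
proof -
  consider "t > 0" | "t < 0" | "t = 0" by linarith
  then show ?thesis
  proof cases
    case 1
    have "((\<lambda>t::real. t\<^sup>2) has_real_derivative 2 * t) (at t)"
      by (auto intro!: derivative_eq_intros)
    from has_field_derivative_transform_within_open[OF this, of "{0<..}" "\<lambda>t. (max 0 t)\<^sup>2"] 1
    show ?thesis by auto
  next
    case 2
    have "((\<lambda>t::real. 0) has_real_derivative 0) (at t)" by simp
    from has_field_derivative_transform_within_open[OF this, of "{..<0}" "\<lambda>t. (max 0 t)\<^sup>2"] 2
    show ?thesis by auto
  next
    case 3
    have "((\<lambda>h::real. max 0 h) \<longlongrightarrow> max 0 0) (at 0)"
      by (intro tendsto_intros)
    then have "((\<lambda>h::real. max 0 h) \<longlongrightarrow> 0) (at 0)" by simp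
    then have "((\<lambda>h::real. (max 0 h)\<^sup>2 / h) \<longlongrightarrow> 0) (at 0)"
      by (rule Lim_transform_eventually)
        (auto simp: eventually_at_filter max_def power2_eq_square)
    with 3 show ?thesis by (simp add: DERIV_def)
  qed
qed

lemma DERIV_bump [derivative_intros]:
  assumes "(f has_derivative f') (at x within A)"
  shows "((\<lambda>x. bump (f x)) has_derivative (\<lambda>h. bump' (f x) * f' h)) (at x within A)"
proof -
  have "((\<lambda>s. (s - 1) * (4 - s)) has_real_derivative (5 - 2 * s)) (at s)" for s :: real
    by (auto intro!: derivative_eq_intros)
  from DERIV_chain'[OF this DERIV_max_0_power2] have "(bump has_real_derivative bump' s) (at s)" for s
    unfolding bump_def[abs_def] bump'_def by (simp add: mult.commute mult.left_commute)
  then have "(bump has_derivative (*) (bump' s)) (at s)" for s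
    by (simp add: has_field_derivative_def)
  from has_derivative_compose[OF assms this] show ?thesis .
qed

lemma continuous_on_bump' [continuous_intros]:
  "continuous_on A f \<Longrightarrow> continuous_on A (\<lambda>x. bump' (f x))"
  unfolding bump'_def by (intro continuous_intros)

lemma continuous_on_bump [continuous_intros]:
  "continuous_on A f \<Longrightarrow> continuous_on A (\<lambda>x. bump (f x))"
  unfolding bump_def by (intro continuous_intros)

lemma bump_outside: "s \<le> 1 \<or> s \<ge> 4 \<Longrightarrow> bump s = 0" "s \<le> 1 \<or> s \<ge> 4 \<Longrightarrow> bump' s = 0"
  by (auto simp: bump_def bump'_def max_def zero_le_mult_iff)

lemma bump_nonneg: "bump s \<ge> 0" by (simp add: bump_def)

lemma bump_pos: "1 < s \<Longrightarrow> s < 4 \<Longrightarrow> bump s > 0"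
  by (simp add: bump_def max_def mult_less_0_iff not_le)

lemma has_derivative_sgn:
  fixes y :: "'a::euclidean_space"
  assumes "y \<noteq> 0"
  shows "(sgn has_derivative (\<lambda>h. tangent_proj (sgn y) h /\<^sub>R norm y)) (at y)"
proof -
  have "((\<lambda>y. inverse (norm y) *\<^sub>R y) has_derivative
      (\<lambda>h. inverse (norm y) *\<^sub>R h + (- (inverse (norm y) * (sgn y \<bullet> h) * inverse (norm y))) *\<^sub>R y)) (at y)"
    using has_derivative_norm[OF assms] assms
    by (auto intro!: derivative_eq_intros simp: inner_commute)
  then show ?thesis
    by (simp add: sgn_div_norm[abs_def] tangent_proj_def algebra_simps)
qed

lemma inner_sgn_self: "(y::'a::euclidean_space) \<noteq> 0 \<Longrightarrow> y = norm y *\<^sub>R sgn y"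
  by (simp add: sgn_div_norm)

text \<open>\<open>F (sgn y)\<close> has no control at the origin, where \<open>sgn\<close> jumps
  and leaves the sphere. The factor \<open>g\<close> vanishes on the unit ball, so continuity is
  checked on the two open sets \<open>- {0}\<close> and \<open>ball 0 1\<close>.\<close>

lemma continuous_on_cutoff:
  fixes F :: "'a::euclidean_space \<Rightarrow> 'b::real_normed_vector"
  assumes g: "continuous_on (- {0}) g" and g0: "\<And>y. norm y < 1 \<Longrightarrow> g y = (0::real)"
    and F: "continuous_on (sphere 0 1) F"
  shows "continuous_on A (\<lambda>y. g y *\<^sub>R F (sgn y))"
proof -
  have "continuous_on (- {0}) (\<lambda>y. g y *\<^sub>R F (sgn y))"
    by (intro continuous_intros g continuous_on_compose2[OF F]) (auto simp: norm_sgn split: if_splits)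
  moreover have "continuous_on (ball 0 1) (\<lambda>y. g y *\<^sub>R F (sgn y))"
    by (rule continuous_on_eq[OF continuous_on_const[of _ 0]]) (simp add: g0)
  ultimately have "continuous_on (- {0} \<union> ball 0 1) (\<lambda>y. g y *\<^sub>R F (sgn y))"
    by (intro continuous_on_open_Un) auto
  moreover have "- {0} \<union> ball 0 1 = (UNIV :: 'a set)" by auto
  ultimately show ?thesis using continuous_on_subset by fastforce
qed

text \<open>The division by the norm compensates the factor \<open>1 / norm y\<close> in the
  derivative of \<open>sgn\<close>: differentiating \<open>X (sgn y)\<close> times the bump produces
  exactly this weight.\<close>

definition weight :: "'a::euclidean_space \<Rightarrow> real" where
  "weight y = bump (y \<bullet> y) / norm y"

lemma weight_nonneg: "weight y \<ge> 0"
  by (simp add: weight_def bump_nonneg)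

lemma continuous_on_weight: "continuous_on (- {0}) weight"
  unfolding weight_def[abs_def] by (intro continuous_intros) auto

lemma norm_lt_1_inner: "norm (y::'a::real_inner) < 1 \<Longrightarrow> y \<bullet> y \<le> 1"
  by (metis dot_square_norm less_eq_real_def norm_ge_zero power_le_one)

lemma weight_0: "norm y < 1 \<Longrightarrow> weight y = 0"
  by (simp add: weight_def bump_outside norm_lt_1_inner)

lemma continuous_on_weight_sgn:
  "continuous_on (sphere 0 1) F \<Longrightarrow> continuous_on A (\<lambda>y. weight y * F (sgn y))"
  using continuous_on_cutoff[OF continuous_on_weight weight_0, of F] by simp

text \<open>In polar coordinates this is a fixed positive multiple of the surface integral; the box
  contains the support of \<open>weight\<close>.\<close>

definition sphere_integral :: "('a::euclidean_space \<Rightarrow> real) \<Rightarrow> real" where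
  "sphere_integral f = integral (cbox (-4 *\<^sub>R One) (4 *\<^sub>R One)) (\<lambda>y. weight y * f (sgn y))"

text \<open>The field \<open>y \<mapsto> bump (norm y ^ 2) X (sgn y)\<close> has compact support, and its
  Euclidean divergence is \<open>weight y * sphere_div X (sgn y)\<close>: the gradient of the bump is radial,
  hence orthogonal to \<open>X\<close>.\<close>

lemma sphere_integral_div:
  fixes X :: "'a::euclidean_space \<Rightarrow> 'a"
  assumes X: "sphere_C1 X" and tan: "\<And>x. norm x = 1 \<Longrightarrow> x \<bullet> X x = 0"
  shows "sphere_integral (sphere_div X) = 0"
proof -
  let ?Q = "cbox (-4 *\<^sub>R One) (4 *\<^sub>R One) :: 'a set"
  obtain D where D: "\<And>x. norm x = 1 \<Longrightarrow> (X has_derivative D x) (at x within sphere 0 1)"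
    and Dc: "\<And>h. continuous_on (sphere 0 1) (\<lambda>x. D x h)"
    using sphere_C1E[OF X] by blast
  note Xc = sphere_C1_continuous[OF X]
  define Z where "Z y = bump (y \<bullet> y) *\<^sub>R X (sgn y)" for y
  define Z' where "Z' y h = (2 * bump' (y \<bullet> y) * (y \<bullet> h)) *\<^sub>R X (sgn y)
      + weight y *\<^sub>R D (sgn y) (tangent_proj (sgn y) h)" for y h
  have dZ: "(Z has_derivative Z' y) (at y)" for y
  proof (cases "y = 0")
    case True
    have "(Z has_derivative (\<lambda>h. 0)) (at 0)"
      by (rule has_derivative_transform_within_open[of "\<lambda>y. 0" _ _ _ "ball 0 1"])
        (auto simp: Z_def bump_outside norm_lt_1_inner)
    moreover have "Z' 0 = (\<lambda>h. 0)"
      by (simp add: fun_eq_iff Z'_def bump_outside weight_0)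
    ultimately show ?thesis using True by simp
  next
    case False
    then have n: "norm (sgn y) = 1" by (simp add: norm_sgn)
    interpret D: bounded_linear "D (sgn y)" using D[OF n] by (rule has_derivative_bounded_linear)
    \<comment> \<open>\<open>sgn\<close> maps \<open>- {0}\<close> into the sphere, so the
      derivative of \<open>X\<close> within the sphere is enough for the chain rule; as
      \<open>- {0}\<close> is open, the result is a full derivative at \<open>y\<close>.\<close>
    have "((X \<circ> sgn) has_derivative D (sgn y) \<circ> (\<lambda>h. tangent_proj (sgn y) h /\<^sub>R norm y)) (at y within - {0})"
    proof (rule diff_chain_within)
      show "(X has_derivative D (sgn y)) (at (sgn y) within sgn ` (- {0}))"
        using D[OF n] by (rule has_derivative_subset) (auto simp: norm_sgn split: if_splits)
    qed (rule has_derivative_at_withinI[OF has_derivative_sgn[OF False]])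
    moreover have "at y within - {0} = at y"
      by (rule at_within_open) (use False in auto)
    ultimately have X': "((\<lambda>y. X (sgn y)) has_derivative
        (\<lambda>h. D (sgn y) (tangent_proj (sgn y) h) /\<^sub>R norm y)) (at y)"
      by (simp add: o_def D.scaleR)
    show ?thesis unfolding Z_def Z'_def weight_def
      by (auto intro!: derivative_eq_intros X' simp: fun_eq_iff inner_commute divide_inverse algebra_simps)
  qed
  have Z'c: "continuous_on A (\<lambda>y. Z' y b \<bullet> b)" for b A
  proof -
    have *: "D x (tangent_proj x b) = D x b - (x \<bullet> b) *\<^sub>R D x x'" if "norm x = 1" "x' = x" for x x'
      using D[OF that(1)] that(2) unfolding tangent_proj_def
      by (simp add: linear_diff linear_scale has_derivative_linear)
    \<comment> \<open>Continuity of \<open>D x h\<close> in \<open>x\<close> is known for fixed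
      \<open>h\<close> only, so the moving argument \<open>x\<close> is expanded in the
      basis.\<close>
    have "D x x = (\<Sum>c\<in>Basis. (x \<bullet> c) *\<^sub>R D x c)" if "norm x = 1" for x
    proof -
      have l: "linear (D x)" using D[OF that] by (rule has_derivative_linear)
      have "D x x = D x (\<Sum>c\<in>Basis. (x \<bullet> c) *\<^sub>R c)" by (simp add: euclidean_representation)
      then show ?thesis by (simp only: linear_sum[OF l] linear_scale[OF l])
    qed
    with * have **: "D x (tangent_proj x b) = D x b - (x \<bullet> b) *\<^sub>R (\<Sum>c\<in>Basis. (x \<bullet> c) *\<^sub>R D x c)"
      if "norm x = 1" for x
      using that by metis
    have c: "continuous_on (sphere 0 1) (\<lambda>x. D x (tangent_proj x b))"
      by (rule continuous_on_eq[where f = "\<lambda>x. D x b - (x \<bullet> b) *\<^sub>R (\<Sum>c\<in>Basis. (x \<bullet> c) *\<^sub>R D x c)"])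
        (auto intro!: continuous_intros Dc simp: **)
    have "continuous_on A (\<lambda>y. (2 * bump' (y \<bullet> y) * (y \<bullet> b)) *\<^sub>R X (sgn y))"
      by (rule continuous_on_cutoff)
        (auto intro!: continuous_intros Xc simp: bump_outside norm_lt_1_inner)
    moreover have "continuous_on A (\<lambda>y. weight y *\<^sub>R D (sgn y) (tangent_proj (sgn y) b))"
      by (rule continuous_on_cutoff[OF continuous_on_weight weight_0 c])
    ultimately show ?thesis
      unfolding Z'_def by (intro continuous_on_inner continuous_on_add continuous_on_const)
  qed
  have supp: "Z y = 0" if "norm y > 2" for y
  proof -
    have "norm y * norm y \<ge> 2 * 2" using that by (intro mult_mono) auto
    then show ?thesis by (simp add: Z_def bump_outside dot_square_norm power2_eq_square)
  qed
  have 0: "integral ?Q (\<lambda>y. Z' y b \<bullet> b) = 0" if "b \<in> Basis" for b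
    by (rule integral_partial_derivative_eq_0[of "\<lambda>y. Z y \<bullet> b" "\<lambda>y h. Z' y h \<bullet> b"])
      (use that in \<open>auto intro!: derivative_intros dZ Z'c simp: supp\<close>)
  have eq: "weight y * sphere_div X (sgn y) = (\<Sum>b\<in>Basis. Z' y b \<bullet> b)" for y
  proof (cases "y = 0")
    case False
    then have n: "norm (sgn y) = 1" by (simp add: norm_sgn)
    have "(\<Sum>b\<in>Basis. (2 * bump' (y \<bullet> y) * (y \<bullet> b)) *\<^sub>R X (sgn y) \<bullet> b) = 2 * bump' (y \<bullet> y) * (y \<bullet> X (sgn y))"
      by (simp add: euclidean_inner[of y "X (sgn y)"] sum_distrib_left mult.assoc)
    also have "y \<bullet> X (sgn y) = 0"
      using tan[OF n] by (subst inner_sgn_self[OF False]) simp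
    finally show ?thesis
      by (simp add: Z'_def inner_add_left sum.distrib sphere_div_tangent[OF n D[OF n]] sum_distrib_left)
  qed (simp add: Z'_def bump_outside weight_0)
  show ?thesis
    unfolding sphere_integral_def eq
    by (subst integral_sum) (auto intro!: sum.neutral 0[simplified] integrable_continuous Z'c)
qed

lemma sphere_integral_cong:
  assumes "\<And>x. norm x = 1 \<Longrightarrow> f x = g x"
  shows "sphere_integral f = sphere_integral g"
  unfolding sphere_integral_def
proof (rule integral_cong)
  fix y :: 'a
  show "weight y * f (sgn y) = weight y * g (sgn y)"
    by (cases "y = 0") (simp_all add: weight_0 norm_sgn assms)
qed

lemma sphere_integral_linear:
  assumes "continuous_on (sphere 0 1) f" "continuous_on (sphere 0 1) g"
  shows "sphere_integral (\<lambda>x. c * f x + d * g x) = c * sphere_integral f + d * sphere_integral g"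
proof -
  note i = integrable_continuous[OF continuous_on_weight_sgn[OF assms(1)]]
    integrable_continuous[OF continuous_on_weight_sgn[OF assms(2)]]
  have "sphere_integral (\<lambda>x. c * f x + d * g x) =
      integral (cbox (-4 *\<^sub>R One) (4 *\<^sub>R One)) (\<lambda>y. c * (weight y * f (sgn y)) + d * (weight y * g (sgn y)))"
    unfolding sphere_integral_def by (simp add: algebra_simps)
  also have "\<dots> = c * sphere_integral f + d * sphere_integral g"
    unfolding sphere_integral_def
    by (subst integral_add) (auto intro!: integrable_on_mult_right i)
  finally show ?thesis .
qed

lemma sphere_integral_mono:
  assumes "continuous_on (sphere 0 1) f" "continuous_on (sphere 0 1) g"
    and "\<And>x. norm x = 1 \<Longrightarrow> f x \<le> g x"
  shows "sphere_integral f \<le> sphere_integral g"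
  unfolding sphere_integral_def
proof (rule integral_le)
  fix y :: 'a
  show "weight y * f (sgn y) \<le> weight y * g (sgn y)"
    by (cases "y = 0") (simp_all add: weight_0 norm_sgn assms mult_left_mono weight_nonneg)
qed (intro integrable_continuous continuous_on_weight_sgn assms)+

lemma sphere_integral_eq_0_imp:
  assumes f: "continuous_on (sphere 0 1) f" "\<And>x. norm x = 1 \<Longrightarrow> 0 \<le> f x"
    and 0: "sphere_integral f = 0" and x: "norm x = 1"
  shows "f x = 0"
proof -
  have nn: "0 \<le> weight y * f (sgn y)" for y :: 'a
    by (cases "y = 0") (simp_all add: weight_0 norm_sgn f weight_nonneg)
  have "box (-4 *\<^sub>R One) (4 *\<^sub>R One :: 'a) \<noteq> {}"
    by (simp add: box_ne_empty)
  from integral_cbox_eq_0_iff[OF continuous_on_weight_sgn[OF f(1)] this] 0 nn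
  have "weight y * f (sgn y) = 0" if "y \<in> cbox (-4 *\<^sub>R One) (4 *\<^sub>R One)" for y
    using that by (simp add: sphere_integral_def)
  \<comment> \<open>A point on the ray through \<open>x\<close> inside the shell where the weight is
    positive: its squared norm is 9/4, between 1 and 4.\<close>
  moreover have "(3/2) *\<^sub>R x \<in> cbox (-4 *\<^sub>R One) (4 *\<^sub>R One)"
  proof -
    have "\<bar>x \<bullet> i\<bar> \<le> 1" if "i \<in> Basis" for i using Basis_le_norm[OF that, of x] x by simp
    then show ?thesis by (force simp: mem_box abs_le_iff)
  qed
  ultimately have "weight ((3/2) *\<^sub>R x) * f (sgn ((3/2) *\<^sub>R x)) = 0" by blast
  moreover have "weight ((3/2) *\<^sub>R x) > 0"
    using x bump_pos[of "9/4"] by (auto simp: weight_def dot_square_norm power2_eq_square intro!: divide_pos_pos)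
  moreover have "sgn ((3/2) *\<^sub>R x) = x" using x by (simp add: sgn_div_norm)
  ultimately show ?thesis by simp
qed

text \<open>Green's identity: the tangent field u grad v - v grad u has divergence equal to the
  integrand, since the two products of gradients cancel.\<close>

lemma laplace_beltrami_symmetric:
  fixes u v :: "'a::euclidean_space \<Rightarrow> real"
  assumes u: "sphere_C2 u" and v: "sphere_C2 v"
  shows "sphere_integral (\<lambda>x. u x * laplace_beltrami v x - v x * laplace_beltrami u x) = 0"
proof -
  have C: "sphere_C1 u" "sphere_C1 v" "sphere_C1 (sphere_grad u)" "sphere_C1 (sphere_grad v)"
    using assms by (auto simp: sphere_C2_def)
  note uv = sphere_C1_scaleR[OF C(1,4)] sphere_C1_scaleR[OF C(2,3)]
  let ?X = "\<lambda>x. 1 *\<^sub>R (u x *\<^sub>R sphere_grad v x) + (-1) *\<^sub>R (v x *\<^sub>R sphere_grad u x)"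
  have "sphere_integral (sphere_div ?X) = 0"
  proof (rule sphere_integral_div)
    show "sphere_C1 ?X"
      by (intro sphere_C1_add sphere_C1_scaleR[OF sphere_C1_const] uv)
    show "x \<bullet> ?X x = 0" if "norm x = 1" for x
      using sphere_grad_deriv(1)[OF C(1) that] sphere_grad_deriv(1)[OF C(2) that]
      by (simp add: inner_diff_right)
  qed
  also have "sphere_integral (sphere_div ?X) =
      sphere_integral (\<lambda>x. u x * laplace_beltrami v x - v x * laplace_beltrami u x)"
  proof (rule sphere_integral_cong)
    fix x :: 'a assume x: "norm x = 1"
    show "sphere_div ?X x = u x * laplace_beltrami v x - v x * laplace_beltrami u x"
      using sphere_div_linear[OF uv x, of 1 "-1"] sphere_div_scaleR[OF C(1,4) x] sphere_div_scaleR[OF C(2,3) x]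
      by (simp add: laplace_beltrami_def inner_commute)
  qed
  finally show ?thesis .
qed

section \<open>Polynomials on the sphere\<close>

definition monomial :: "('a::euclidean_space \<Rightarrow> nat) \<Rightarrow> 'a \<Rightarrow> real" where
  "monomial a x = (\<Prod>b\<in>Basis. (x \<bullet> b) ^ a b)"

text \<open>At \<open>a b = 0\<close> truncated subtraction leaves the index unchanged; the
  derivatives below then carry the factor \<open>real (a b) = 0\<close>.\<close>

definition decr :: "('a \<Rightarrow> nat) \<Rightarrow> 'a \<Rightarrow> 'a \<Rightarrow> nat" where
  "decr a b = a(b := a b - 1)"

text \<open>Exponents are pinned to 0 off the basis, so that each monomial has one multi-index and
  the set is finite.\<close>

definition midx :: "nat \<Rightarrow> ('a::euclidean_space \<Rightarrow> nat) set" where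
  "midx d = {a. (\<forall>x. x \<notin> Basis \<longrightarrow> a x = 0) \<and> sum a Basis = d}"

definition on_sphere :: "('a::euclidean_space \<Rightarrow> real) \<Rightarrow> 'a \<Rightarrow> real" where
  "on_sphere f x = (if norm x = 1 then f x else 0)"

text \<open>\<open>sphere_poly K\<close> consists of the polynomials of degree strictly below \<open>K\<close>, so that
  \<open>sphere_poly 0\<close> is trivial.\<close>

definition sphere_poly :: "nat \<Rightarrow> ('a::euclidean_space \<Rightarrow> real) set" where
  "sphere_poly K = fun_space.span (\<Union>d<K. (\<lambda>a. on_sphere (monomial a)) ` midx d)"

text \<open>\<open>N\<close> is the dimension of the ambient space; with \<open>N = n + 1\<close>
  this is K (K + n - 1).\<close>

definition eigval :: "nat \<Rightarrow> nat \<Rightarrow> real" where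
  "eigval N K = real K * (real K + real N - 2)"

lemma monomial_decr:
  assumes "b \<in> Basis"
  shows "real (a b) * monomial (decr a b) x * (x \<bullet> b) = real (a b) * monomial a x"
proof (cases "a b = 0")
  case False
  then have "(x \<bullet> b) ^ (a b - 1) * (x \<bullet> b) = (x \<bullet> b) ^ a b"
    by (metis One_nat_def Suc_pred mult.commute neq0_conv power_Suc)
  moreover have "(\<Prod>c\<in>Basis - {b}. (x \<bullet> c) ^ decr a b c) = (\<Prod>c\<in>Basis - {b}. (x \<bullet> c) ^ a c)"
    by (rule prod.cong) (auto simp: decr_def)
  ultimately show ?thesis
    using assms by (simp add: monomial_def prod.remove[OF finite_Basis assms] decr_def)
qed simp

definition monomial_grad :: "('a::euclidean_space \<Rightarrow> nat) \<Rightarrow> 'a \<Rightarrow> 'a" where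
  "monomial_grad a x = (\<Sum>b\<in>Basis. (real (a b) * monomial (decr a b) x) *\<^sub>R b)"

lemma has_derivative_monomial:
  "(monomial a has_derivative (\<lambda>h. monomial_grad a x \<bullet> h)) (at x within A)"
proof -
  have *: "real (a b) * (h \<bullet> b) * (x \<bullet> b) ^ (a b - 1) * (\<Prod>j\<in>Basis - {b}. (x \<bullet> j) ^ a j) =
     real (a b) * monomial (decr a b) x * (b \<bullet> h)" if "b \<in> Basis" for b h
  proof -
    have "(\<Prod>j\<in>Basis - {b}. (x \<bullet> j) ^ a j) = (\<Prod>j\<in>Basis - {b}. (x \<bullet> j) ^ decr a b j)"
      by (rule prod.cong) (auto simp: decr_def)
    then show ?thesis
      by (simp add: monomial_def prod.remove[OF finite_Basis that] decr_def inner_commute)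
  qed
  have "(monomial a has_derivative (\<lambda>h. \<Sum>b\<in>Basis. real (a b) * (h \<bullet> b) * (x \<bullet> b) ^ (a b - 1) *
      (\<Prod>j\<in>Basis - {b}. (x \<bullet> j) ^ a j))) (at x within A)"
    unfolding monomial_def[abs_def]
    by (rule has_derivative_prod) (auto intro!: derivative_eq_intros simp: fun_eq_iff)
  moreover have "(\<lambda>h. \<Sum>b\<in>Basis. real (a b) * (h \<bullet> b) * (x \<bullet> b) ^ (a b - 1) *
      (\<Prod>j\<in>Basis - {b}. (x \<bullet> j) ^ a j)) = (\<lambda>h. monomial_grad a x \<bullet> h)"
    unfolding monomial_grad_def inner_sum_left inner_scaleR_left
    by (intro ext sum.cong refl) (simp only: *)
  ultimately show ?thesis by simp
qed

lemma continuous_on_monomial: "continuous_on A (monomial a)"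
  unfolding monomial_def[abs_def] by (intro continuous_intros)

lemma continuous_on_monomial_grad: "continuous_on A (monomial_grad a)"
  unfolding monomial_grad_def[abs_def]
  by (intro continuous_intros continuous_on_monomial)

text \<open>Euler's identity for homogeneous functions.\<close>

lemma inner_monomial_grad:
  "x \<bullet> monomial_grad a x = real (sum a Basis) * monomial a x"
proof -
  have "x \<bullet> monomial_grad a x = (\<Sum>b\<in>Basis. real (a b) * monomial (decr a b) x * (x \<bullet> b))"
    by (simp add: monomial_grad_def inner_sum_right)
  also have "\<dots> = (\<Sum>b\<in>Basis. real (a b) * monomial a x)"
    by (rule sum.cong) (simp_all add: monomial_decr)
  finally show ?thesis by (simp add: sum_distrib_right)
qed

lemma inner_monomial_grad_Basis:
  "b \<in> Basis \<Longrightarrow> monomial_grad a x \<bullet> b = real (a b) * monomial (decr a b) x"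
  by (simp add: monomial_grad_def inner_sum_left inner_Basis if_distrib cong: if_cong)

lemma sum_decr:
  assumes "b \<in> Basis" "a b > 0"
  shows "sum (decr a b) (Basis :: 'a::euclidean_space set) = sum a Basis - 1"
proof -
  have "sum (decr a b) (Basis - {b}) = sum a (Basis - {b})"
    by (rule sum.cong) (auto simp: decr_def)
  then show ?thesis
    using assms by (simp add: sum.remove[OF finite_Basis assms(1)] decr_def)
qed

text \<open>For degree d, Euler's identity turns the radial terms of the ambient formula into d (d -
  1) + (N - 1) d = d (d + N - 2) times the monomial. The right-hand side is the Euclidean Laplacian,
  of degree d - 2.\<close>

lemma laplace_beltrami_monomial:
  fixes a :: "'a::euclidean_space \<Rightarrow> nat"
  shows "sphere_C2 (monomial a)"
    and "norm x = 1 \<Longrightarrow> laplace_beltrami (monomial a) x + eigval DIM('a) (sum a Basis) * monomial a x =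
      (\<Sum>b\<in>Basis. real (a b) * real (a b - 1) * monomial (decr (decr a b) b) x)"
proof -
  define H where "H x h = (\<Sum>b\<in>Basis. (real (a b) * (monomial_grad (decr a b) x \<bullet> h)) *\<^sub>R b)" for x h :: 'a
  have "((\<lambda>x. \<Sum>b\<in>Basis. (real (a b) * monomial (decr a b) x) *\<^sub>R b) has_derivative H x) (at x)" for x
    unfolding H_def
    by (intro has_derivative_sum has_derivative_scaleR_left has_derivative_mult_right has_derivative_monomial)
  then have dH: "(monomial_grad a has_derivative H x) (at x)" for x
    by (simp only: monomial_grad_def[abs_def])
  have Hc: "continuous_on UNIV (\<lambda>x. H x h)" for h
    unfolding H_def by (intro continuous_intros continuous_on_monomial_grad)
  note LB = laplace_beltrami_ambient[OF has_derivative_monomial dH Hc]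
  show "sphere_C2 (monomial a)" by (rule LB(1))
  assume x: "norm x = 1"
  let ?d = "real (sum a Basis)"
  have tr: "H x b \<bullet> b = real (a b) * real (a b - 1) * monomial (decr (decr a b) b) x" if "b \<in> Basis" for b
    using that inner_monomial_grad_Basis[OF that, of "decr a b" x]
    by (simp add: H_def inner_sum_left inner_Basis if_distrib decr_def cong: if_cong)
  have xHx: "x \<bullet> H x x = ?d * (?d - 1) * monomial a x"
  proof -
    have "x \<bullet> H x x = (\<Sum>b\<in>Basis. real (a b) * (x \<bullet> monomial_grad (decr a b) x) * (x \<bullet> b))"
      by (simp add: H_def inner_sum_right inner_commute)
    also have "\<dots> = (\<Sum>b\<in>Basis. (?d - 1) * (real (a b) * monomial (decr a b) x * (x \<bullet> b)))"
    proof (rule sum.cong)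
      fix b :: 'a assume b: "b \<in> Basis"
      show "real (a b) * (x \<bullet> monomial_grad (decr a b) x) * (x \<bullet> b) =
          (?d - 1) * (real (a b) * monomial (decr a b) x * (x \<bullet> b))"
      proof (cases "a b = 0")
        case False
        moreover have "a b \<le> sum a Basis" using b by (intro member_le_sum) auto
        ultimately have "real (sum (decr a b) Basis) = ?d - 1"
          using sum_decr[OF b, of a] by (simp add: of_nat_diff del: of_nat_sum)
        then show ?thesis by (simp add: inner_monomial_grad del: of_nat_sum)
      qed simp
    qed simp
    also have "\<dots> = (\<Sum>b\<in>Basis. (?d - 1) * (real (a b) * monomial a x))"
      by (intro sum.cong refl arg_cong2[where f = "(*)"] monomial_decr)
    finally show ?thesis by (simp add: sum_distrib_left[symmetric] sum_distrib_right[symmetric])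
  qed
  have "laplace_beltrami (monomial a) x =
      (\<Sum>b\<in>Basis. H x b \<bullet> b) - ?d * (?d - 1) * monomial a x - (real DIM('a) - 1) * (?d * monomial a x)"
    using LB(2)[OF x] by (simp only: xHx inner_monomial_grad)
  also have "(\<Sum>b\<in>Basis. H x b \<bullet> b) =
      (\<Sum>b\<in>Basis. real (a b) * real (a b - 1) * monomial (decr (decr a b) b) x)"
    by (rule sum.cong) (simp_all add: tr)
  finally show "laplace_beltrami (monomial a) x + eigval DIM('a) (sum a Basis) * monomial a x =
      (\<Sum>b\<in>Basis. real (a b) * real (a b - 1) * monomial (decr (decr a b) b) x)"
    by (simp add: eigval_def algebra_simps del: of_nat_sum)
qed

lemma on_sphere_sphere [simp]: "norm x = 1 \<Longrightarrow> on_sphere f x = f x"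
  by (simp add: on_sphere_def)

lemma subspace_sphere_poly: "fun_space.subspace (sphere_poly K)"
  by (simp add: sphere_poly_def)

lemma sphere_poly_add: "f \<in> sphere_poly K \<Longrightarrow> g \<in> sphere_poly K \<Longrightarrow> (\<lambda>x. f x + g x) \<in> sphere_poly K"
  using fun_space.subspace_add[OF subspace_sphere_poly, of f K g] by (simp add: plus_fun_def)

lemma sphere_poly_scale: "f \<in> sphere_poly K \<Longrightarrow> (\<lambda>x. c * f x) \<in> sphere_poly K"
  using fun_space.subspace_scale[OF subspace_sphere_poly] .

lemma sphere_poly_linear:
  "f \<in> sphere_poly K \<Longrightarrow> g \<in> sphere_poly K \<Longrightarrow> (\<lambda>x. c * f x + d * g x) \<in> sphere_poly K"
  by (intro sphere_poly_add sphere_poly_scale)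

lemma sphere_poly_0: "(\<lambda>x. 0) \<in> sphere_poly K"
  using fun_space.subspace_0[OF subspace_sphere_poly] by (simp add: zero_fun_def)

lemma sphere_poly_sum:
  "(\<And>i. i \<in> I \<Longrightarrow> f i \<in> sphere_poly K) \<Longrightarrow> (\<lambda>x. \<Sum>i\<in>I. f i x) \<in> sphere_poly K"
  by (induction I rule: infinite_finite_induct) (auto intro: sphere_poly_0 sphere_poly_add)

lemma sphere_poly_monomial: "a \<in> midx d \<Longrightarrow> d < K \<Longrightarrow> on_sphere (monomial a) \<in> sphere_poly K"
  unfolding sphere_poly_def by (rule fun_space.span_base) auto

lemma sphere_poly_mono: "j \<le> K \<Longrightarrow> sphere_poly j \<subseteq> sphere_poly K"
  unfolding sphere_poly_def by (intro fun_space.span_mono UN_mono) auto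

lemma sphere_poly_zero_degree: "f \<in> sphere_poly 0 \<Longrightarrow> f = (\<lambda>x. 0)"
  by (simp add: sphere_poly_def zero_fun_def)

lemma sphere_poly_induct [consumes 1, case_names zero linear monomial]:
  assumes "f \<in> sphere_poly K"
    and "P (\<lambda>x. 0)"
    and "\<And>f g c d. P f \<Longrightarrow> P g \<Longrightarrow> P (\<lambda>x. c * f x + d * g x)"
    and "\<And>a d. a \<in> midx d \<Longrightarrow> d < K \<Longrightarrow> P (on_sphere (monomial a))"
  shows "P f"
  using assms(1) unfolding sphere_poly_def
proof (induction rule: fun_space.span_induct)
  case base
  have "P (f + g)" if "P f" "P g" for f g :: "'a \<Rightarrow> real"
    using assms(3)[OF that, of 1 1] by (simp add: plus_fun_def)
  moreover have "P (\<lambda>x. c * f x)" if "P f" for f :: "'a \<Rightarrow> real" and c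
    using assms(3)[OF that assms(2), of c 0] by simp
  ultimately show ?case
    using assms(2) by (auto simp: fun_space.subspace_def zero_fun_def)
qed (use assms(4) in auto)

lemma sphere_C2_const: "sphere_C2 (\<lambda>x. c)" "norm x = 1 \<Longrightarrow> laplace_beltrami (\<lambda>x. c) x = 0"
  using laplace_beltrami_ambient[of "\<lambda>x. c" "\<lambda>x. 0" "\<lambda>x h. 0"] by (auto simp: has_derivative_const)

lemma sphere_poly_C2: "f \<in> sphere_poly K \<Longrightarrow> sphere_C2 f"
proof (induction rule: sphere_poly_induct)
  case (monomial a d)
  show ?case by (rule sphere_C2_cong(1)[OF laplace_beltrami_monomial(1)]) simp
qed (simp_all add: sphere_C2_const sphere_C2_linear)

lemma sphere_poly_off: "f \<in> sphere_poly K \<Longrightarrow> norm x \<noteq> 1 \<Longrightarrow> f x = 0"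
  by (induction rule: sphere_poly_induct) (simp_all add: on_sphere_def)

lemma decr_midx:
  assumes "a \<in> midx d" "b \<in> Basis" "a b > 0"
  shows "decr a b \<in> midx (d - 1)"
  using assms sum_decr[of b a] by (auto simp: midx_def) (auto simp: decr_def)

lemma on_sphere_sum: "on_sphere (\<lambda>x. \<Sum>i\<in>I. f i x) = (\<lambda>x. \<Sum>i\<in>I. on_sphere (f i) x)"
  by (auto simp: on_sphere_def)

lemma on_sphere_scale: "on_sphere (\<lambda>x. c * f x) = (\<lambda>x. c * on_sphere f x)"
  by (auto simp: on_sphere_def)

lemma on_sphere_add: "on_sphere (\<lambda>x. f x + g x) = (\<lambda>x. on_sphere f x + on_sphere g x)"
  by (auto simp: on_sphere_def)

lemma on_sphere_cong: "(\<And>x. norm x = 1 \<Longrightarrow> f x = g x) \<Longrightarrow> on_sphere f = on_sphere g"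
  by (auto simp: on_sphere_def)

lemma sphere_poly_laplace_monomial:
  fixes a :: "'a::euclidean_space \<Rightarrow> nat"
  assumes a: "a \<in> midx d"
  shows "on_sphere (\<lambda>x. laplace_beltrami (on_sphere (monomial a)) x + eigval DIM('a) d * monomial a x) \<in> sphere_poly d"
proof -
  have "on_sphere (\<lambda>x. laplace_beltrami (on_sphere (monomial a)) x + eigval DIM('a) d * monomial a x)
    = on_sphere (\<lambda>x. \<Sum>b\<in>Basis. real (a b) * real (a b - 1) * monomial (decr (decr a b) b) x)"
  proof (rule on_sphere_cong)
    fix x :: 'a assume x: "norm x = 1"
    have "laplace_beltrami (on_sphere (monomial a)) x = laplace_beltrami (monomial a) x"
      by (rule sphere_C2_cong(3)[OF laplace_beltrami_monomial(1) _ x]) simp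
    then show "laplace_beltrami (on_sphere (monomial a)) x + eigval DIM('a) d * monomial a x =
        (\<Sum>b\<in>Basis. real (a b) * real (a b - 1) * monomial (decr (decr a b) b) x)"
      using laplace_beltrami_monomial(2)[OF x, of a] a by (simp add: midx_def)
  qed
  also have "\<dots> \<in> sphere_poly d"
    unfolding on_sphere_sum on_sphere_scale
  proof (rule sphere_poly_sum)
    fix b :: 'a assume b: "b \<in> Basis"
    show "(\<lambda>x. real (a b) * real (a b - 1) * on_sphere (monomial (decr (decr a b) b)) x) \<in> sphere_poly d"
    proof (cases "a b \<ge> 2")
      case True
      then have 1: "decr a b \<in> midx (d - 1)" using decr_midx[OF a b] by simp
      have 2: "decr (decr a b) b \<in> midx (d - 1 - 1)"
        by (rule decr_midx[OF 1 b]) (use True in \<open>simp add: decr_def\<close>)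
      have "a b \<le> d" using a b member_le_sum[of b Basis a] by (auto simp: midx_def)
      then show ?thesis using True
        by (intro sphere_poly_scale sphere_poly_monomial[OF 2]) auto
    next
      case False
      then have "real (a b) * real (a b - 1) = 0" by auto
      then show ?thesis by (simp only: mult_zero_left sphere_poly_0)
    qed
  qed
  finally show ?thesis .
qed

lemma sphere_poly_laplace:
  fixes f :: "'a::euclidean_space \<Rightarrow> real"
  assumes "f \<in> sphere_poly (Suc K)"
  shows "on_sphere (\<lambda>x. laplace_beltrami f x + eigval DIM('a) K * f x) \<in> sphere_poly K"
proof -
  have "sphere_C2 f \<and> on_sphere (\<lambda>x. laplace_beltrami f x + eigval DIM('a) K * f x) \<in> sphere_poly K"
    using assms
  proof (induction rule: sphere_poly_induct)
    case zero
    have "on_sphere (\<lambda>x. laplace_beltrami (\<lambda>x. 0) x + eigval DIM('a) K * 0) = (\<lambda>x::'a. 0)"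
      by (auto simp: on_sphere_def sphere_C2_const)
    then show ?case by (simp add: sphere_C2_const sphere_poly_0)
  next
    case (linear f g c d)
    then have C: "sphere_C2 f" "sphere_C2 g" by auto
    have "on_sphere (\<lambda>x. laplace_beltrami (\<lambda>x. c * f x + d * g x) x + eigval DIM('a) K * (c * f x + d * g x))
      = (\<lambda>x. c * on_sphere (\<lambda>x. laplace_beltrami f x + eigval DIM('a) K * f x) x
           + d * on_sphere (\<lambda>x. laplace_beltrami g x + eigval DIM('a) K * g x) x)"
      by (auto simp: on_sphere_def sphere_C2_linear[OF C] algebra_simps)
    then show ?case using linear sphere_poly_linear sphere_C2_linear(1)[OF C] by auto
  next
    case (monomial a d)
    let ?m = "on_sphere (monomial a)"
    have C: "sphere_C2 ?m" by (rule sphere_C2_cong(1)[OF laplace_beltrami_monomial(1)]) simp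
    have 1: "on_sphere (\<lambda>x. laplace_beltrami ?m x + eigval DIM('a) d * monomial a x) \<in> sphere_poly K"
      using sphere_poly_laplace_monomial[OF monomial(1)] sphere_poly_mono[of d K] monomial(2) by auto
    \<comment> \<open>Replacing the eigenvalue of degree \<open>d\<close> by that of degree
      \<open>K\<close> costs a multiple of the monomial itself: for \<open>d < K\<close> it has
      admissible degree, for \<open>d = K\<close> the coefficient is 0.\<close>
    have 2: "(\<lambda>x. (eigval DIM('a) K - eigval DIM('a) d) * ?m x) \<in> sphere_poly K"
    proof (cases "d = K")
      case False
      with monomial show ?thesis by (intro sphere_poly_scale sphere_poly_monomial) auto
    qed (simp add: sphere_poly_0)
    have "on_sphere (\<lambda>x. laplace_beltrami ?m x + eigval DIM('a) K * ?m x) =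
       (\<lambda>x. on_sphere (\<lambda>x. laplace_beltrami ?m x + eigval DIM('a) d * monomial a x) x
          + (eigval DIM('a) K - eigval DIM('a) d) * ?m x)"
      by (auto simp: on_sphere_def algebra_simps)
    with C sphere_poly_add[OF 1 2] show ?case by simp
  qed
  then show ?thesis by simp
qed

section \<open>Inverting the shifted Laplacian degree by degree\<close>

lemma eigval_strict_mono:
  assumes "N \<ge> 2" "j < K" shows "eigval N j < eigval N K"
proof -
  have "real j * (real j + real N - 2) \<le> real j * (real K + real N - 2)"
    using assms by (intro mult_left_mono) auto
  also have "\<dots> < real K * (real K + real N - 2)"
    using assms by (intro mult_strict_right_mono) auto
  finally show ?thesis by (simp add: eigval_def)
qed

lemma eigval_eq_iff: "N \<ge> 2 \<Longrightarrow> eigval N j = eigval N K \<longleftrightarrow> j = K"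
  using eigval_strict_mono[of N j K] eigval_strict_mono[of N K j] by (cases j K rule: linorder_cases) auto

text \<open>Write L i for the Laplacian plus \<open>eigval DIM('a) i\<close>. Given \<open>w\<close>
  of degree at most j, L j w has smaller degree, so induction provides z with L K z = L j w. Then L
  K (w - z) is \<open>w\<close> times the difference of the eigenvalues for K and j, which is
  nonzero as j < K.\<close>

lemma sphere_poly_solve:
  fixes w :: "'a::euclidean_space \<Rightarrow> real"
  assumes N: "DIM('a) \<ge> 2"
  shows "j \<le> K \<Longrightarrow> w \<in> sphere_poly j \<Longrightarrow>
    \<exists>z\<in>sphere_poly j. \<forall>x. norm x = 1 \<longrightarrow> laplace_beltrami z x + eigval DIM('a) K * z x = w x"
proof (induction j arbitrary: w)
  case 0
  then show ?case by (auto dest!: sphere_poly_zero_degree intro!: bexI[OF _ sphere_poly_0] simp: sphere_C2_const)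
next
  case (Suc j)
  let ?e = "eigval DIM('a)"
  let ?r = "on_sphere (\<lambda>x. laplace_beltrami w x + ?e j * w x)"
  define \<delta> where "\<delta> = ?e K - ?e j"
  have \<delta>: "\<delta> \<noteq> 0" using eigval_strict_mono[OF N, of j K] Suc.prems by (simp add: \<delta>_def)
  from Suc.IH[OF _ sphere_poly_laplace[OF Suc.prems(2)]] Suc.prems(1)
  obtain z where z: "z \<in> sphere_poly j"
    and zr: "\<And>x. norm x = 1 \<Longrightarrow> laplace_beltrami z x + ?e K * z x = laplace_beltrami w x + ?e j * w x"
    by auto
  have zS: "z \<in> sphere_poly (Suc j)" using z sphere_poly_mono[of j "Suc j"] by auto
  note C = sphere_poly_C2[OF Suc.prems(2)] sphere_poly_C2[OF z]
  show ?case
  proof (intro bexI allI impI)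
    show "(\<lambda>x. (1 / \<delta>) * w x + (- 1 / \<delta>) * z x) \<in> sphere_poly (Suc j)"
      by (rule sphere_poly_linear[OF Suc.prems(2) zS])
    fix x :: 'a assume x: "norm x = 1"
    have "laplace_beltrami (\<lambda>x. (1 / \<delta>) * w x + (- 1 / \<delta>) * z x) x + ?e K * ((1 / \<delta>) * w x + (- 1 / \<delta>) * z x)
      = (laplace_beltrami w x + ?e K * w x - (laplace_beltrami z x + ?e K * z x)) / \<delta>"
      by (simp only: sphere_C2_linear(2)[OF C x]) (simp add: field_simps \<delta>)
    also have "\<dots> = (\<delta> * w x) / \<delta>" unfolding zr[OF x] by (simp add: \<delta>_def algebra_simps)
    finally show "laplace_beltrami (\<lambda>x. (1 / \<delta>) * w x + (- 1 / \<delta>) * z x) x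
        + ?e K * ((1 / \<delta>) * w x + (- 1 / \<delta>) * z x) = w x" using \<delta> by simp
  qed
qed

text \<open>The spherical harmonics of degree \<open>K\<close>. The degree restriction keeps the
  space within reach of linear algebra until it is shown to be the whole eigenspace.\<close>

definition harmonics :: "nat \<Rightarrow> ('a::euclidean_space \<Rightarrow> real) set" where
  "harmonics K = eigenspace (eigval DIM('a) K) \<inter> sphere_poly (Suc K)"

lemma subspace_eigenspace: "fun_space.subspace (eigenspace \<mu>)"
proof -
  have l: "(\<lambda>x. c * u x + d * v x) \<in> eigenspace \<mu>"
    if "u \<in> eigenspace \<mu>" "v \<in> eigenspace \<mu>" for u v :: "'a \<Rightarrow> real" and c d
  proof -
    have C: "sphere_C2 u" "sphere_C2 v"
      and e: "\<And>x. norm x = 1 \<Longrightarrow> laplace_beltrami u x = - \<mu> * u x"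
        "\<And>x. norm x = 1 \<Longrightarrow> laplace_beltrami v x = - \<mu> * v x"
      using that by (auto simp: eigenspace_def add_eq_0_iff)
    show ?thesis
      using that by (auto simp: eigenspace_def sphere_C2_linear[OF C] e algebra_simps)
  qed
  have 0: "(\<lambda>x. 0) \<in> eigenspace \<mu>" by (auto simp: eigenspace_def sphere_C2_const)
  show ?thesis
    unfolding fun_space.subspace_def
    using l[of _ _ 1 1] l[OF _ 0, of _ _ 0] 0 by (auto simp: zero_fun_def plus_fun_def)
qed

lemma subspace_harmonics: "fun_space.subspace (harmonics K)"
  unfolding harmonics_def
  by (intro fun_space.subspace_inter subspace_eigenspace subspace_sphere_poly)

text \<open>The shifted Laplacian sends \<open>v\<close> into \<open>sphere_poly K\<close>, where
  the image also has a preimage \<open>z\<close> of lower degree; the difference of \<open>v\<close>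
  and \<open>z\<close> is annihilated.\<close>

lemma sphere_poly_Suc_decompose:
  fixes v :: "'a::euclidean_space \<Rightarrow> real"
  assumes N: "DIM('a) \<ge> 2" and v: "v \<in> sphere_poly (Suc K)"
  obtains e z where "e \<in> harmonics K" "z \<in> sphere_poly K" "v = e + z"
proof -
  from sphere_poly_solve[OF N order_refl sphere_poly_laplace[OF v]]
  obtain z where z: "z \<in> sphere_poly K"
    and eq: "\<And>x. norm x = 1 \<Longrightarrow> laplace_beltrami z x + eigval DIM('a) K * z x =
      laplace_beltrami v x + eigval DIM('a) K * v x" by auto
  have zS: "z \<in> sphere_poly (Suc K)" using z sphere_poly_mono[of K "Suc K"] by auto
  note C = sphere_poly_C2[OF v] sphere_poly_C2[OF z]
  let ?e = "\<lambda>x. 1 * v x + (-1) * z x"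
  have "?e \<in> sphere_poly (Suc K)" by (rule sphere_poly_linear[OF v zS])
  moreover have "laplace_beltrami ?e x + eigval DIM('a) K * ?e x = 0" if "norm x = 1" for x
    using eq[OF that] by (simp only: sphere_C2_linear(2)[OF C that]) (simp add: algebra_simps)
  ultimately have "?e \<in> harmonics K"
    using sphere_C2_linear(1)[OF C, of 1 "-1"] sphere_poly_off[OF v] sphere_poly_off[OF z]
    by (auto simp: harmonics_def eigenspace_def)
  then show ?thesis by (rule that[OF _ z]) (auto simp: plus_fun_def)
qed

text \<open>The Laplacian shifted by a lower eigenvalue multiplies \<open>v\<close> by a nonzero
  number and yet lowers its degree, so \<open>v\<close> descends to
  \<open>sphere_poly 0\<close>.\<close>

lemma sphere_poly_eigenspace_trivial:
  fixes v :: "'a::euclidean_space \<Rightarrow> real"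
  assumes N: "DIM('a) \<ge> 2" and e: "v \<in> eigenspace (eigval DIM('a) K)"
  shows "j \<le> K \<Longrightarrow> v \<in> sphere_poly j \<Longrightarrow> v = 0"
proof (induction j)
  case 0
  then show ?case by (auto dest: sphere_poly_zero_degree simp: zero_fun_def)
next
  case (Suc j)
  let ?e = "eigval DIM('a)"
  define \<delta> where "\<delta> = ?e j - ?e K"
  have \<delta>: "\<delta> \<noteq> 0" using eigval_strict_mono[OF N, of j K] Suc.prems by (simp add: \<delta>_def)
  have "on_sphere (\<lambda>x. laplace_beltrami v x + ?e j * v x) = (\<lambda>x. \<delta> * v x)"
    using e by (auto simp: on_sphere_def eigenspace_def \<delta>_def add_eq_0_iff2 algebra_simps)
  with sphere_poly_laplace[OF Suc.prems(2)] have "(\<lambda>x. \<delta> * v x) \<in> sphere_poly j" by simp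
  from sphere_poly_scale[OF this, of "1 / \<delta>"] \<delta> have "v \<in> sphere_poly j" by simp
  with Suc show ?case by simp
qed

section \<open>Dimension count\<close>

text \<open>Induction on the variables: as a polynomial in the one variable \<open>b\<close>, with
  the others fixed, the sum has all positive reals as roots, so each coefficient vanishes. Vanishing
  is assumed at positive points only; such points are not the origin and can be scaled to the
  sphere.\<close>

lemma polynomial_coeffs_eq_0:
  fixes c :: "('b \<Rightarrow> nat) \<Rightarrow> real"
  assumes "finite B" "finite I"
    and "\<And>a a'. a \<in> I \<Longrightarrow> a' \<in> I \<Longrightarrow> (\<And>b. b \<in> B \<Longrightarrow> a b = a' b) \<Longrightarrow> a = a'"
    and "\<And>y :: 'b \<Rightarrow> real. (\<And>b. y b > 0) \<Longrightarrow> (\<Sum>a\<in>I. c a * (\<Prod>b\<in>B. y b ^ a b)) = 0"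
    and "a \<in> I"
  shows "c a = 0"
  using assms
proof (induction B arbitrary: I a rule: finite_induct)
  case empty
  then have "I = {a}" by blast
  with empty.prems(3)[of "\<lambda>_. 1"] show ?case by simp
next
  case (insert b B)
  define J where "J i = {a \<in> I. a b = i}" for i
  define n where "n = Max ((\<lambda>a. a b) ` I)"
  have n: "a b \<le> n" if "a \<in> I" for a :: "'b \<Rightarrow> nat" using that insert.prems(1) by (simp add: n_def)
  have z: "(\<Sum>a\<in>J i. c a * (\<Prod>b\<in>B. y b ^ a b)) = 0" if y: "\<And>b. y b > 0" and i: "i \<le> n" for y :: "'b \<Rightarrow> real" and i
  proof (rule ccontr)
    let ?q = "\<lambda>i. \<Sum>a\<in>J i. c a * (\<Prod>b\<in>B. y b ^ a b)"
    assume "?q i \<noteq> 0"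
    then have fin: "finite {t. (\<Sum>i\<le>n. ?q i * t ^ i) = 0}"
      using polyfun_finite_roots[of ?q n] i by blast
    have "(\<Sum>i\<le>n. ?q i * t ^ i) = 0" if t: "t > 0" for t :: real
    proof -
      have "(\<Sum>i\<le>n. ?q i * t ^ i) = (\<Sum>i\<le>n. \<Sum>a\<in>J i. c a * (\<Prod>e\<in>insert b B. (y(b := t)) e ^ a e))"
      proof (intro sum.cong refl, unfold sum_distrib_right, intro sum.cong refl)
        fix i a assume "a \<in> J i"
        moreover have "(\<Prod>e\<in>B. (y(b := t)) e ^ a e) = (\<Prod>b\<in>B. y b ^ a b)"
          by (rule prod.cong) (use insert.hyps in auto)
        ultimately show "c a * (\<Prod>b\<in>B. y b ^ a b) * t ^ i = c a * (\<Prod>e\<in>insert b B. (y(b := t)) e ^ a e)"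
          using insert.hyps by (simp add: J_def)
      qed
      also have "\<dots> = (\<Sum>a\<in>I. c a * (\<Prod>e\<in>insert b B. (y(b := t)) e ^ a e))"
        unfolding J_def using n by (intro sum.group insert.prems) auto
      also have "\<dots> = 0" by (rule insert.prems(3)) (use y t in auto)
      finally show ?thesis .
    qed
    then have "{0<..} \<subseteq> {t. (\<Sum>i\<le>n. ?q i * t ^ i) = 0}" by auto
    from finite_subset[OF this fin] show False by (simp add: infinite_Ioi)
  qed
  show ?case
  proof (rule insert.IH[of "J (a b)"])
    show "finite (J (a b))" using insert.prems by (simp add: J_def)
    show "a' = a''" if "a' \<in> J (a b)" "a'' \<in> J (a b)" "\<And>b. b \<in> B \<Longrightarrow> a' b = a'' b" for a' a''
      by (rule insert.prems(2)) (use that in \<open>auto simp: J_def\<close>)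
    show "(\<Sum>a\<in>J (a b). c a * (\<Prod>b\<in>B. y b ^ a b)) = 0" if "\<And>b. y b > 0" for y :: "'b \<Rightarrow> real"
      by (rule z) (use that n insert.prems in auto)
    show "a \<in> J (a b)" using insert.prems by (simp add: J_def)
  qed
qed

text \<open>Enumerating the basis reduces the count of multi-indices to that of lists with
  prescribed length and sum.\<close>

lemma midx_bij_lists:
  obtains xs :: "'a::euclidean_space list"
  where "bij_betw (\<lambda>a. map a xs) (midx d) {l. length l = DIM('a) \<and> sum_list l = d}"
proof -
  obtain xs :: "'a list" where xs: "set xs = Basis" "distinct xs"
    using finite_distinct_list[OF finite_Basis] by blast
  have len: "length xs = DIM('a)" using distinct_card[OF xs(2)] xs(1) by simp
  have sum: "sum_list (map a xs) = sum a Basis" for a :: "'a \<Rightarrow> nat"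
    using sum_list_distinct_conv_sum_set[OF xs(2), of a] xs(1) by simp
  have "bij_betw (\<lambda>a. map a xs) (midx d) {l. length l = DIM('a) \<and> sum_list l = d}"
    unfolding bij_betw_def
  proof (intro conjI inj_onI set_eqI iffI)
    fix a a' :: "'a \<Rightarrow> nat" assume a: "a \<in> midx d" "a' \<in> midx d" "map a xs = map a' xs"
    show "a = a'"
    proof
      fix x show "a x = a' x"
        by (cases "x \<in> Basis") (use a xs in \<open>auto simp: midx_def\<close>)
    qed
  next
    fix l assume "l \<in> (\<lambda>a. map a xs) ` midx d"
    then show "l \<in> {l. length l = DIM('a) \<and> sum_list l = d}"
      by (auto simp: midx_def sum len)
  next
    fix l assume l: "l \<in> {l. length l = DIM('a) \<and> sum_list l = d}"
    define a where "a x = (case map_of (zip xs l) x of None \<Rightarrow> 0 | Some v \<Rightarrow> v)" for x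
    have m: "map a xs = l"
      by (rule nth_equalityI) (use l len xs(2) in \<open>auto simp: a_def map_of_zip_nth\<close>)
    have "a x = 0" if "x \<notin> Basis" for x
    proof -
      have "map_of (zip xs l) x = None" using that xs(1) l len by (simp add: map_of_zip_is_None)
      then show ?thesis by (simp add: a_def)
    qed
    then have "a \<in> midx d" using m sum[of a] l by (auto simp: midx_def)
    with m show "l \<in> (\<lambda>a. map a xs) ` midx d" by auto
  qed
  then show ?thesis by (rule that)
qed

lemma card_midx: "card (midx d :: ('a::euclidean_space \<Rightarrow> nat) set) = (d + DIM('a) - 1) choose d"
  by (rule midx_bij_lists[where 'a = 'a and d = d])
    (drule bij_betw_same_card, simp add: card_length_sum_list)

lemma finite_midx: "finite (midx d :: ('a::euclidean_space \<Rightarrow> nat) set)"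
proof -
  have "finite {l :: nat list. length l = DIM('a) \<and> sum_list l = d}"
    by (rule finite_subset[OF _ finite_lists_length_eq[of "{..d}" "DIM('a)"]])
      (auto dest: member_le_sum_list)
  moreover obtain xs :: "'a list"
    where "bij_betw (\<lambda>a. map a xs) (midx d) {l. length l = DIM('a) \<and> sum_list l = d}"
    by (rule midx_bij_lists)
  ultimately show ?thesis by (simp add: bij_betw_finite)
qed

lemma midx_disjoint: "d \<noteq> e \<Longrightarrow> midx d \<inter> midx e = {}"
  by (auto simp: midx_def)

lemma monomial_scale: "a \<in> midx d \<Longrightarrow> monomial a (t *\<^sub>R x) = t ^ d * monomial a x"
  by (auto simp: monomial_def midx_def power_mult_distrib prod.distrib power_sum)

text \<open>On the sphere, multiplication by \<open>x \<bullet> x = 1\<close> raises the degree by two, so the monomials of the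
  two highest degrees form a basis.\<close>

definition top_midx :: "nat \<Rightarrow> ('a::euclidean_space \<Rightarrow> nat) set" where
  "top_midx K = (\<Union>d\<in>{d. d + 1 = K \<or> d + 2 = K}. midx d)"

lemma finite_top_midx: "finite (top_midx K)"
proof -
  have "finite {d. d + 1 = K \<or> d + 2 = K}"
    by (rule finite_subset[of _ "{..K}"]) auto
  then show ?thesis unfolding top_midx_def by (simp add: finite_midx)
qed

text \<open>Homogeneity carries the relation from the sphere to all nonzero points, where the
  coefficients of a polynomial are determined.\<close>

lemma monomial_coeffs_eq_0:
  fixes c :: "('a::euclidean_space \<Rightarrow> nat) \<Rightarrow> real"
  assumes "\<And>x. norm x = 1 \<Longrightarrow> (\<Sum>a\<in>midx d. c a * monomial a x) = 0" and a: "a \<in> midx d"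
  shows "c a = 0"
proof (rule polynomial_coeffs_eq_0[OF finite_Basis finite_midx _ _ a])
  show "a = a'" if "a \<in> midx d" "a' \<in> midx d" "\<And>b. b \<in> Basis \<Longrightarrow> a b = a' b" for a a' :: "'a \<Rightarrow> nat"
  proof
    fix x show "a x = a' x" by (cases "x \<in> Basis") (use that in \<open>auto simp: midx_def\<close>)
  qed
  fix y :: "'a \<Rightarrow> real" assume y: "\<And>b. y b > 0"
  define x where "x = (\<Sum>b\<in>Basis. y b *\<^sub>R b)"
  have xb: "x \<bullet> b = y b" if "b \<in> Basis" for b
    using that by (simp add: x_def)
  have "x \<noteq> 0"
  proof
    assume "x = 0"
    then have "y (SOME b. b \<in> Basis) = 0" using xb[OF SOME_Basis] by simp
    then show False using y less_irrefl by metis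
  qed
  have "(\<Sum>a\<in>midx d. c a * (\<Prod>b\<in>Basis. y b ^ a b)) = (\<Sum>a\<in>midx d. c a * monomial a x)"
    by (intro sum.cong refl) (simp add: monomial_def xb)
  also have "\<dots> = (\<Sum>a\<in>midx d. c a * monomial a (norm x *\<^sub>R sgn x))"
    using inner_sgn_self[OF \<open>x \<noteq> 0\<close>] by simp
  also have "\<dots> = norm x ^ d * (\<Sum>a\<in>midx d. c a * monomial a (sgn x))"
    unfolding sum_distrib_left by (intro sum.cong refl) (simp add: monomial_scale)
  also have "\<dots> = 0" using assms(1)[of "sgn x"] \<open>x \<noteq> 0\<close> by (simp add: norm_sgn)
  finally show "(\<Sum>a\<in>midx d. c a * (\<Prod>b\<in>Basis. y b ^ a b)) = 0" .
qed

lemma top_midx_split: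
  "top_midx (Suc (Suc d)) = midx (Suc d) \<union> midx d" "top_midx (Suc 0) = midx 0" "top_midx 0 = {}"
proof -
  have "{e. e + 1 = Suc (Suc d) \<or> e + 2 = Suc (Suc d)} = {Suc d, d}"
    "{e. e + 1 = Suc 0 \<or> e + 2 = Suc 0} = {0}" by auto
  then show "top_midx (Suc (Suc d)) = midx (Suc d) \<union> midx d" "top_midx (Suc 0) = midx 0" "top_midx 0 = {}"
    unfolding top_midx_def by (simp_all only: UN_insert UN_empty Un_empty_right) auto
qed

text \<open>The two degrees have opposite parity, so comparing \<open>x\<close> with
  \<open>- x\<close> makes the two homogeneous parts vanish on the sphere separately.\<close>

lemma top_monomial_coeffs_eq_0:
  fixes c :: "('a::euclidean_space \<Rightarrow> nat) \<Rightarrow> real"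
  assumes z: "\<And>x. norm x = 1 \<Longrightarrow> (\<Sum>a\<in>top_midx K. c a * monomial a x) = 0" and a: "a \<in> top_midx K"
  shows "c a = 0"
proof -
  consider "K = 0" | "K = Suc 0" | d where "K = Suc (Suc d)" by (metis nat.exhaust)
  then show ?thesis
  proof cases
    case 1
    then show ?thesis using a by (simp add: top_midx_split)
  next
    case 2
    show ?thesis by (rule monomial_coeffs_eq_0[of c 0 a]) (use z a 2 in \<open>auto simp: top_midx_split\<close>)
  next
    case 3
    define p where "p e x = (\<Sum>a\<in>midx e. c a * monomial a x)" for e and x :: 'a
    have s: "p (Suc d) x + p d x = 0" if "norm x = 1" for x
      using z[OF that] unfolding 3 top_midx_split p_def
      by (subst (asm) sum.union_disjoint) (simp_all add: finite_midx midx_disjoint)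
    have odd: "p e (- x) = (-1) ^ e * p e x" for e x
    proof -
      have "p e ((-1) *\<^sub>R x) = (-1) ^ e * p e x"
        unfolding p_def sum_distrib_left
        by (intro sum.cong refl) (simp only: monomial_scale mult.left_commute)
      then show ?thesis by simp
    qed
    have "p e x = 0" if "norm x = 1" "e = d \<or> e = Suc d" for e x
    proof -
      have "p (Suc d) (- x) + p d (- x) = 0" using s[of "- x"] that by simp
      then have "(-1) ^ d * (p d x - p (Suc d) x) = 0" unfolding odd by (simp add: algebra_simps)
      then have "p d x = p (Suc d) x" by simp
      with s[OF that(1)] that(2) show ?thesis by auto
    qed
    with monomial_coeffs_eq_0[of c d a] monomial_coeffs_eq_0[of c "Suc d" a] a
    show ?thesis by (auto simp: 3 top_midx_split p_def)
  qed
qed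

lemma inj_on_top_monomial:
  "inj_on (\<lambda>a. on_sphere (monomial a)) (top_midx K :: ('a::euclidean_space \<Rightarrow> nat) set)"
proof (rule inj_onI, rule ccontr)
  fix a a' :: "'a \<Rightarrow> nat"
  assume a: "a \<in> top_midx K" "a' \<in> top_midx K" and eq: "on_sphere (monomial a) = on_sphere (monomial a')"
    and ne: "a \<noteq> a'"
  define c where "c b = (if b = a then 1 else if b = a' then -1 else 0 :: real)" for b
  have "(\<Sum>b\<in>top_midx K. c b * monomial b x) = 0" if x: "norm x = 1" for x
  proof -
    have "(\<Sum>b\<in>top_midx K. c b * monomial b x) = (\<Sum>b\<in>{a, a'}. c b * monomial b x)"
      by (rule sum.mono_neutral_right) (use a finite_top_midx in \<open>auto simp: c_def\<close>)
    also have "\<dots> = monomial a x - monomial a' x" using ne by (simp add: c_def)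
    also have "\<dots> = 0" using fun_cong[OF eq, of x] x by simp
    finally show ?thesis .
  qed
  from top_monomial_coeffs_eq_0[OF this a(1)] show False by (simp add: c_def)
qed

definition top_basis :: "nat \<Rightarrow> ('a::euclidean_space \<Rightarrow> real) set" where
  "top_basis K = (\<lambda>a. on_sphere (monomial a)) ` top_midx K"

lemma sum_fun_apply: "(\<Sum>i\<in>I. f i) x = (\<Sum>i\<in>I. f i x :: real)"
  by (induction I rule: infinite_finite_induct) auto

lemma independent_top_basis:
  "fun_space.independent (top_basis K :: ('a::euclidean_space \<Rightarrow> real) set)"
proof (rule fun_space.independent_if_scalars_zero)
  show "finite (top_basis K)" by (simp add: top_basis_def finite_top_midx)
  fix c :: "('a \<Rightarrow> real) \<Rightarrow> real" and f :: "'a \<Rightarrow> real"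
  assume z: "(\<Sum>f\<in>top_basis K. (\<lambda>x. c f * f x)) = 0" and f: "f \<in> top_basis K"
  have "(\<Sum>a\<in>top_midx K. c (on_sphere (monomial a)) * monomial a x) = 0" if x: "norm x = 1" for x :: 'a
    using fun_cong[OF z, of x] x
    by (simp add: sum_fun_apply top_basis_def sum.reindex[OF inj_on_top_monomial])
  from top_monomial_coeffs_eq_0[OF this] f show "c f = 0" by (auto simp: top_basis_def)
qed

lemma span_top_basis: "fun_space.span (top_basis K) = (sphere_poly K :: ('a::euclidean_space \<Rightarrow> real) set)"
proof
  show "fun_space.span (top_basis K) \<subseteq> (sphere_poly K :: ('a \<Rightarrow> real) set)"
    by (rule fun_space.span_minimal[OF _ subspace_sphere_poly])
      (auto simp: top_basis_def top_midx_def intro: sphere_poly_monomial)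
  have m: "on_sphere (monomial a) \<in> fun_space.span (top_basis K)" if "a \<in> midx d" "d < K" for a :: "'a \<Rightarrow> nat" and d
    using that
  \<comment> \<open>In the remaining case \<open>d + 2 < K\<close>, and multiplication by the sum of
    the squared coordinates rewrites the monomial as a sum of monomials of degree
    \<open>d + 2\<close>.\<close>
  proof (induction "K - d" arbitrary: d a rule: less_induct)
    case less
    show ?case
    proof (cases "d + 1 = K \<or> d + 2 = K")
      case True
      then show ?thesis using less.prems
        by (intro fun_space.span_base) (auto simp: top_basis_def top_midx_def)
    next
      case False
      define i where "i b = a(b := a b + 2)" for b
      have i: "i b \<in> midx (d + 2)" if "b \<in> Basis" for b
      proof -
        have "sum (i b) (Basis - {b}) = sum a (Basis - {b})"
          by (rule sum.cong) (auto simp: i_def)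
        then show ?thesis using less.prems(1) that
          by (auto simp: midx_def sum.remove[OF finite_Basis that] i_def)
      qed
      have "monomial (i b) x = (x \<bullet> b)\<^sup>2 * monomial a x" if "b \<in> Basis" for b x
      proof -
        have "(\<Prod>c\<in>Basis - {b}. (x \<bullet> c) ^ i b c) = (\<Prod>c\<in>Basis - {b}. (x \<bullet> c) ^ a c)"
          by (rule prod.cong) (auto simp: i_def)
        then show ?thesis
          by (simp add: monomial_def prod.remove[OF finite_Basis that]) (simp add: i_def power_add power2_eq_square)
      qed
      then have "on_sphere (monomial a) x = (\<Sum>b\<in>Basis. on_sphere (monomial (i b)) x)" for x
        by (simp add: on_sphere_def sum_distrib_right[symmetric] norm_eq_1
            euclidean_inner[of x x] power2_eq_square)
      then have "on_sphere (monomial a) = (\<Sum>b\<in>Basis. on_sphere (monomial (i b)))"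
        by (simp add: fun_eq_iff sum_fun_apply)
      also have "\<dots> \<in> fun_space.span (top_basis K)"
        using less.prems False by (intro fun_space.span_sum less.hyps[OF _ i]) auto
      finally show ?thesis .
    qed
  qed
  show "sphere_poly K \<subseteq> fun_space.span (top_basis K :: ('a \<Rightarrow> real) set)"
    unfolding sphere_poly_def by (rule fun_space.span_minimal) (auto intro: m)
qed

text \<open>The multiplicity is a difference of binomials two steps apart, so the sum telescopes to
  two terms. These count the multi-indices of degrees \<open>K - 1\<close> and \<open>K - 2\<close>;
  at \<open>K = 0\<close> both binomials are 0.\<close>

lemma chain_sum_eq:
  assumes "n \<ge> 2"
  shows "chain_sum n K = ((n + K - 1) choose n) + ((n + K - 2) choose n)"
proof (induction K)
  case (Suc K)
  have "((n + K - 2) choose n) \<le> ((n + K) choose n)" by (rule binomial_right_mono) simp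
  moreover have "chain_sum n (Suc K) = chain_sum n K + chain_mult n K"
    by (simp add: chain_sum_def)
  ultimately show ?case
    using assms by (simp add: Suc chain_mult_def numeral_2_eq_2)
qed (use assms in \<open>simp add: chain_sum_def\<close>)

lemma card_top_basis:
  assumes n: "n \<ge> 2" "DIM('a::euclidean_space) = n + 1"
  shows "card (top_basis K :: ('a \<Rightarrow> real) set) = chain_sum n K"
proof -
  have c: "card (midx d :: ('a \<Rightarrow> nat) set) = (n + d) choose n" for d
    using binomial_symmetric[of d "d + n"] by (simp add: card_midx n add.commute)
  have "card (top_midx K :: ('a \<Rightarrow> nat) set) = chain_sum n K"
  proof -
    consider "K = 0" | "K = Suc 0" | d where "K = Suc (Suc d)" by (metis nat.exhaust)
    then show ?thesis
    proof cases
      case 3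
      then show ?thesis using n(1)
        by (simp add: chain_sum_eq top_midx_split card_Un_disjoint finite_midx midx_disjoint c)
    qed (use n(1) in \<open>simp_all add: chain_sum_eq top_midx_split c\<close>)
  qed
  then show ?thesis by (simp add: top_basis_def card_image inj_on_top_monomial)
qed

lemma finite_top_basis: "finite (top_basis K)"
  by (simp add: top_basis_def finite_top_midx)

lemma independent_Un:
  assumes B: "fun_space.independent B" and C: "fun_space.independent C"
    and BC: "fun_space.span B \<inter> fun_space.span C \<subseteq> {0}"
  shows "fun_space.independent (B \<union> C)" and "B \<inter> C = {}"
proof -
  have "0 \<notin> B" using B fun_space.dependent_zero by blast
  then show "B \<inter> C = {}" using BC fun_space.span_base by blast
  show "fun_space.independent (B \<union> C)"
    unfolding fun_space.independent_explicit_module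
  proof (intro allI impI)
    fix t v and u :: "('a \<Rightarrow> real) \<Rightarrow> real"
    assume t: "finite t" "t \<subseteq> B \<union> C" and z: "(\<Sum>v\<in>t. (\<lambda>x. u v * v x)) = 0" and v: "v \<in> t"
    let ?s = "\<lambda>t. \<Sum>v\<in>t. (\<lambda>x. u v * v x)"
    have "?s t = ?s (t \<inter> B) + ?s (t - B)"
      using t(1) by (rule sum.Int_Diff)
    with z have s: "?s (t \<inter> B) = - ?s (t - B)" by (simp add: eq_neg_iff_add_eq_0)
    have sB: "?s (t \<inter> B) \<in> fun_space.span B"
      by (intro fun_space.span_sum fun_space.span_scale fun_space.span_base) auto
    have sC: "?s (t - B) \<in> fun_space.span C"
      by (intro fun_space.span_sum fun_space.span_scale fun_space.span_base) (use t in auto)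
    have "?s (t \<inter> B) = 0" using sB fun_space.span_neg[OF sC] BC unfolding s by auto
    moreover from this have "?s (t - B) = 0" using s by simp
    ultimately show "u v = 0"
      using fun_space.independentD[OF B, of "t \<inter> B" u v] fun_space.independentD[OF C, of "t - B" u v] t v
      by (cases "v \<in> B") auto
  qed
qed

text \<open>A basis of the harmonics together with \<open>top_basis K\<close> is a basis of
  \<open>sphere_poly (Suc K)\<close>, and so is \<open>top_basis (Suc K)\<close>. The bijection
  between them gives finiteness and, by subtraction, the multiplicity.\<close>

lemma harmonics_basis:
  assumes n: "n \<ge> 2" "DIM('a::euclidean_space) = n + 1"
  obtains B :: "('a::euclidean_space \<Rightarrow> real) set" where "fun_space.independent B" "fun_space.span B = harmonics K"
    "finite B" "card B = chain_mult n K"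
proof -
  have N: "DIM('a) \<ge> 2" using n by simp
  obtain B :: "('a \<Rightarrow> real) set" where B: "B \<subseteq> harmonics K" "fun_space.independent B" "harmonics K \<subseteq> fun_space.span B"
    by (rule fun_space.basis_exists[of "harmonics K :: ('a \<Rightarrow> real) set"]) (rule that)
  have sB: "fun_space.span B = harmonics K"
    using B fun_space.span_minimal[OF B(1) subspace_harmonics] by auto
  have "fun_space.span B \<inter> fun_space.span (top_basis K) \<subseteq> {0}"
    unfolding sB span_top_basis
    using sphere_poly_eigenspace_trivial[OF N _ order_refl] by (auto simp: harmonics_def)
  note ind = independent_Un[OF B(2) independent_top_basis this]
  have "fun_space.span (B \<union> top_basis K) = sphere_poly (Suc K)"
    unfolding fun_space.span_Un sB span_top_basis
  proof (intro equalityI subsetI)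
    fix v :: "'a \<Rightarrow> real" assume "v \<in> {x + y |x y. x \<in> harmonics K \<and> y \<in> sphere_poly K}"
    then obtain x y where v: "v = x + y" "x \<in> harmonics K" "y \<in> sphere_poly K" by auto
    have "x \<in> sphere_poly (Suc K)" "y \<in> sphere_poly (Suc K)"
      using v sphere_poly_mono[of K "Suc K"] by (auto simp: harmonics_def)
    then show "v \<in> sphere_poly (Suc K)"
      unfolding v(1) by (rule fun_space.subspace_add[OF subspace_sphere_poly])
  next
    fix v :: "'a \<Rightarrow> real" assume "v \<in> sphere_poly (Suc K)"
    then obtain e z where "e \<in> harmonics K" "z \<in> sphere_poly K" "v = e + z"
      by (rule sphere_poly_Suc_decompose[OF N])
    then show "v \<in> {x + y |x y. x \<in> harmonics K \<and> y \<in> sphere_poly K}" by auto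
  qed
  then have "fun_space.span (B \<union> top_basis K) = fun_space.span (top_basis (Suc K))"
    by (simp add: span_top_basis)
  from fun_space.bij_if_span_eq_span_bases[OF ind(1) independent_top_basis this]
  obtain f where f: "bij_betw f (B \<union> top_basis K) (top_basis (Suc K) :: ('a \<Rightarrow> real) set)" by blast
  have fin: "finite (B \<union> top_basis K)"
    using bij_betw_finite[OF f] finite_top_basis by blast
  have "chain_sum n (Suc K) = card (B \<union> top_basis K)"
    using bij_betw_same_card[OF f] by (simp add: card_top_basis[OF n])
  also have "\<dots> = card B + chain_sum n K"
    using fin ind(2) by (simp add: card_Un_disjoint card_top_basis[OF n])
  finally have "card B = chain_mult n K" by (simp add: chain_sum_def)
  with fin B(2) sB show ?thesis by (intro that[of B]) auto
qed

section \<open>Completeness and the eigenvalue sequence\<close>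

definition sphere_inner :: "('a::euclidean_space \<Rightarrow> real) \<Rightarrow> ('a \<Rightarrow> real) \<Rightarrow> real" where
  "sphere_inner u v = sphere_integral (\<lambda>x. u x * v x)"

lemma sphere_inner_commute: "sphere_inner u v = sphere_inner v u"
  by (simp add: sphere_inner_def mult.commute)

lemma sphere_inner_linear:
  assumes "continuous_on (sphere 0 1) u" "continuous_on (sphere 0 1) v" "continuous_on (sphere 0 1) w"
  shows "sphere_inner u (\<lambda>x. c * v x + d * w x) = c * sphere_inner u v + d * sphere_inner u w"
proof -
  have "sphere_inner u (\<lambda>x. c * v x + d * w x) = sphere_integral (\<lambda>x. c * (u x * v x) + d * (u x * w x))"
    by (simp add: sphere_inner_def algebra_simps)
  also have "\<dots> = c * sphere_inner u v + d * sphere_inner u w"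
    unfolding sphere_inner_def by (intro sphere_integral_linear continuous_intros assms)
  finally show ?thesis .
qed

lemma sphere_inner_self_eq_0:
  assumes "continuous_on (sphere 0 1) u" "sphere_inner u u = 0" "norm x = 1"
  shows "u x = 0"
proof -
  have "u x * u x = 0"
    by (rule sphere_integral_eq_0_imp[of "\<lambda>x. u x * u x"])
      (use assms in \<open>auto simp: sphere_inner_def intro!: continuous_intros\<close>)
  then show ?thesis by simp
qed

lemma sphere_C2_continuous: "sphere_C2 u \<Longrightarrow> continuous_on (sphere 0 1) u"
  by (simp add: sphere_C2_def sphere_C1_continuous)

lemma eigenspace_continuous: "u \<in> eigenspace \<mu> \<Longrightarrow> continuous_on (sphere 0 1) u"
  by (simp add: eigenspace_def sphere_C2_continuous)

lemma sphere_poly_continuous: "u \<in> sphere_poly K \<Longrightarrow> continuous_on (sphere 0 1) u"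
  by (intro sphere_C2_continuous sphere_poly_C2)

lemma eigenspace_orthogonal:
  fixes u v :: "'a::euclidean_space \<Rightarrow> real"
  assumes u: "u \<in> eigenspace \<mu>" and v: "v \<in> eigenspace \<nu>" and ne: "\<mu> \<noteq> \<nu>"
  shows "sphere_inner u v = 0"
proof -
  note c = eigenspace_continuous[OF u] eigenspace_continuous[OF v]
  have "0 = sphere_integral (\<lambda>x. u x * laplace_beltrami v x - v x * laplace_beltrami u x)"
    using u v by (simp add: eigenspace_def laplace_beltrami_symmetric)
  also have "\<dots> = sphere_integral (\<lambda>x. (\<mu> - \<nu>) * (u x * v x) + 0 * (u x * v x))"
    by (rule sphere_integral_cong) (use u v in \<open>auto simp: eigenspace_def add_eq_0_iff2 algebra_simps\<close>)
  also have "\<dots> = (\<mu> - \<nu>) * sphere_inner u v"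
    unfolding sphere_inner_def by (subst sphere_integral_linear) (auto intro!: continuous_intros c)
  finally show ?thesis using ne by simp
qed

lemma sphere_poly_mult:
  fixes f g :: "'a::euclidean_space \<Rightarrow> real"
  assumes "f \<in> sphere_poly K" "g \<in> sphere_poly L"
  shows "(\<lambda>x. f x * g x) \<in> sphere_poly (K + L)"
  using assms(1)
proof (induction rule: sphere_poly_induct)
  case (linear f1 f2 c d)
  then show ?case using sphere_poly_linear[of "\<lambda>x. f1 x * g x" "K + L" "\<lambda>x. f2 x * g x" c d]
    by (simp add: algebra_simps)
next
  case (monomial a d)
  show ?case using assms(2)
  proof (induction rule: sphere_poly_induct)
    case (linear g1 g2 c d)
    then show ?case
      using sphere_poly_linear[of "\<lambda>x. on_sphere (monomial a) x * g1 x" "K + L"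
          "\<lambda>x. on_sphere (monomial a) x * g2 x" c d]
      by (simp add: algebra_simps)
  next
    case (monomial b e)
    have m: "(\<lambda>x. a x + b x) \<in> midx (d + e)"
      using monomial \<open>a \<in> midx d\<close> by (auto simp: midx_def sum.distrib)
    have "(\<lambda>x. on_sphere (monomial a) x * on_sphere (monomial b) x) = on_sphere (monomial (\<lambda>x. a x + b x))"
      by (auto simp: on_sphere_def monomial_def power_add prod.distrib)
    then show ?case
      using sphere_poly_monomial[OF m, of "K + L"] monomial \<open>d < K\<close> by simp
  qed (simp add: sphere_poly_0)
qed (simp add: sphere_poly_0)

lemma real_polynomial_on_sphere:
  fixes f :: "'a::euclidean_space \<Rightarrow> real"
  assumes "real_polynomial_function f"
  shows "\<exists>K. on_sphere f \<in> sphere_poly K"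
  using assms
proof (induction rule: real_polynomial_function.induct)
  case (linear f)
  define e where "e b = (\<lambda>c. if c = b then 1 else 0 :: nat)" for b :: 'a
  have e: "e b \<in> midx 1" if "b \<in> Basis" for b
    using that by (auto simp: midx_def e_def)
  have eb: "monomial (e b) x = x \<bullet> b" if "b \<in> Basis" for b x :: 'a
  proof -
    have "monomial (e b) x = (\<Prod>c\<in>Basis. if c = b then x \<bullet> b else 1)"
      unfolding monomial_def by (intro prod.cong refl) (simp add: e_def)
    then show ?thesis using that by simp
  qed
  have fx: "f x = (\<Sum>b\<in>Basis. f b * monomial (e b) x)" for x
  proof -
    have "f x = (\<Sum>b\<in>Basis. f b * (b \<bullet> x))"
      using linear_functional_eq_inner[OF bounded_linear.linear[OF linear], of x]
      by (simp only: inner_sum_left inner_scaleR_left)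
    also have "\<dots> = (\<Sum>b\<in>Basis. f b * monomial (e b) x)"
      by (intro sum.cong refl) (simp add: eb inner_commute)
    finally show ?thesis .
  qed
  have "on_sphere f = on_sphere (\<lambda>x. \<Sum>b\<in>Basis. f b * monomial (e b) x)"
    by (rule on_sphere_cong) (rule fx)
  then have "on_sphere f = (\<lambda>x. \<Sum>b\<in>Basis. f b * on_sphere (monomial (e b)) x)"
    unfolding on_sphere_sum on_sphere_scale .
  moreover have "\<dots> \<in> sphere_poly 2"
    by (intro sphere_poly_sum sphere_poly_scale sphere_poly_monomial[OF e]) auto
  ultimately show ?case by auto
next
  case (const c)
  have "on_sphere (\<lambda>x::'a. c) = (\<lambda>x. c * on_sphere (monomial (\<lambda>_. 0)) x)"
    by (auto simp: on_sphere_def monomial_def)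
  moreover have "\<dots> \<in> sphere_poly 1"
    by (intro sphere_poly_scale sphere_poly_monomial[of _ 0]) (auto simp: midx_def)
  ultimately show ?case by auto
next
  case (add f g)
  then obtain K L where f: "on_sphere f \<in> sphere_poly K" and g: "on_sphere g \<in> sphere_poly L" by auto
  have "on_sphere f \<in> sphere_poly (K + L)" "on_sphere g \<in> sphere_poly (K + L)"
    using f g sphere_poly_mono[of K "K + L"] sphere_poly_mono[of L "K + L"] by auto
  then show ?case using sphere_poly_add by (auto simp: on_sphere_add)
next
  case (mult f g)
  then obtain K L where f: "on_sphere f \<in> sphere_poly K" and g: "on_sphere g \<in> sphere_poly L" by auto
  have "on_sphere (\<lambda>x. f x * g x) = (\<lambda>x. on_sphere f x * on_sphere g x)"
    by (auto simp: on_sphere_def)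
  then show ?case using sphere_poly_mult[OF f g] by auto
qed

text \<open>If a polynomial g is uniformly within e of \<open>u\<close>, orthogonality gives (u, u)
  = (u, u - g), which is at most e times the integral of the absolute value of
  \<open>u\<close>.\<close>

lemma orthogonal_polynomials_eq_0:
  fixes u :: "'a::euclidean_space \<Rightarrow> real"
  assumes u: "continuous_on (sphere 0 1) u"
    and orth: "\<And>K p. p \<in> sphere_poly K \<Longrightarrow> sphere_inner u p = 0"
    and x: "norm x = 1"
  shows "u x = 0"
proof -
  define C where "C = sphere_integral (\<lambda>x. \<bar>u x\<bar>)"
  have le: "sphere_inner u u \<le> e * C" if e: "e > 0" for e
  proof -
    obtain g where g: "real_polynomial_function g" and ug: "\<And>x. x \<in> sphere 0 1 \<Longrightarrow> \<bar>u x - g x\<bar> < e"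
      using Stone_Weierstrass_real_polynomial_function[OF compact_sphere u e] by blast
    obtain K where K: "on_sphere g \<in> sphere_poly K"
      using real_polynomial_on_sphere[OF g] by blast
    have "sphere_inner u u = sphere_inner u (\<lambda>x. 1 * u x + (-1) * on_sphere g x)"
      using sphere_inner_linear[OF u u sphere_poly_continuous[OF K], of 1 "-1"] orth[OF K] by simp
    also have "\<dots> \<le> sphere_integral (\<lambda>x. e * \<bar>u x\<bar> + 0 * \<bar>u x\<bar>)"
      unfolding sphere_inner_def
    proof (rule sphere_integral_mono)
      fix x :: 'a assume x: "norm x = 1"
      have "u x * (u x - g x) \<le> \<bar>u x\<bar> * \<bar>u x - g x\<bar>"
        by (metis abs_ge_self abs_mult)
      also have "\<dots> \<le> \<bar>u x\<bar> * e" using ug[of x] x by (intro mult_left_mono) auto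
      finally show "u x * (1 * u x + (-1) * on_sphere g x) \<le> e * \<bar>u x\<bar> + 0 * \<bar>u x\<bar>"
        using x by (simp add: mult.commute)
    qed (intro continuous_intros u sphere_poly_continuous[OF K])+
    also have "\<dots> = e * C"
      unfolding C_def by (subst sphere_integral_linear) (auto intro!: continuous_intros u)
    finally show ?thesis .
  qed
  have "C \<ge> sphere_integral (\<lambda>x::'a. 0)"
    unfolding C_def by (rule sphere_integral_mono) (auto intro!: continuous_intros u)
  then have C: "C \<ge> 0" by (simp add: sphere_integral_def)
  have "sphere_inner u u \<le> 0"
  proof (rule field_le_epsilon)
    fix e :: real assume e: "e > 0"
    \<comment> \<open>The denominator \<open>C + 1\<close> covers the case
      \<open>C = 0\<close>.\<close>
    have "sphere_inner u u \<le> e / (C + 1) * C" by (rule le) (use e C in simp)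
    also have "\<dots> \<le> e" using e C by (simp add: field_simps)
    finally show "sphere_inner u u \<le> 0 + e" by simp
  qed
  moreover have "sphere_integral (\<lambda>x::'a. 0) \<le> sphere_inner u u"
    unfolding sphere_inner_def by (rule sphere_integral_mono) (auto intro!: continuous_intros u)
  ultimately have "sphere_inner u u = 0" by (simp add: sphere_integral_def)
  from sphere_inner_self_eq_0[OF u this x] show ?thesis .
qed

lemma span_continuous:
  assumes "\<And>b. b \<in> B \<Longrightarrow> continuous_on (sphere 0 1) b" "p \<in> fun_space.span B"
  shows "continuous_on (sphere 0 1) (p :: 'a::euclidean_space \<Rightarrow> real)"
  using assms(2)
proof (induction rule: fun_space.span_induct)
  case base
  show ?case
    by (auto simp: fun_space.subspace_def zero_fun_def plus_fun_def intro!: continuous_intros)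
qed (rule assms(1))

lemma sphere_inner_span:
  assumes u: "continuous_on (sphere 0 1) u" and B: "\<And>b. b \<in> B \<Longrightarrow> continuous_on (sphere 0 1) b"
    and 0: "\<And>b. b \<in> B \<Longrightarrow> sphere_inner u b = 0" and p: "p \<in> fun_space.span B"
  shows "sphere_inner u (p :: 'a::euclidean_space \<Rightarrow> real) = 0"
proof -
  have "continuous_on (sphere 0 1) p \<and> sphere_inner u p = 0"
    using p
  proof (induction rule: fun_space.span_induct_alt)
    case base
    then show ?case by (simp add: zero_fun_def sphere_inner_def sphere_integral_def)
  next
    case (step c x y)
    have "(\<lambda>z. c * x z) + y = (\<lambda>z. c * x z + 1 * y z)" by (simp add: plus_fun_def)
    then show ?case
      using step B[OF step(1)] 0[OF step(1)] sphere_inner_linear[OF u B[OF step(1)], of y c 1]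
      by (auto intro!: continuous_intros)
  qed
  then show ?thesis ..
qed

text \<open>Gram-Schmidt inside the induction: besides \<open>u\<close>, the new vector
  \<open>b\<close> is projected too, and its remainder \<open>e\<close> supplies the missing
  direction.\<close>

lemma orthogonal_projection:
  fixes u :: "'a::euclidean_space \<Rightarrow> real"
  assumes "finite B" and u: "continuous_on (sphere 0 1) u"
    and "\<And>b. b \<in> B \<Longrightarrow> continuous_on (sphere 0 1) b"
  shows "\<exists>p\<in>fun_space.span B. \<forall>b\<in>B. sphere_inner b (\<lambda>x. u x - p x) = 0"
  using assms
proof (induction B arbitrary: u rule: finite_induct)
  case empty
  then show ?case by simp
next
  case (insert b B)
  have cb: "continuous_on (sphere 0 1) b" and cB: "\<And>b. b \<in> B \<Longrightarrow> continuous_on (sphere 0 1) b"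
    using insert.prems by auto
  obtain p where p: "p \<in> fun_space.span B" "\<And>b. b \<in> B \<Longrightarrow> sphere_inner b (\<lambda>x. u x - p x) = 0"
    using insert.IH[OF insert.prems(1) cB] by blast
  obtain q where q: "q \<in> fun_space.span B" "\<And>c. c \<in> B \<Longrightarrow> sphere_inner c (\<lambda>x. b x - q x) = 0"
    using insert.IH[OF cb cB] by blast
  have cp: "continuous_on (sphere 0 1) p" "continuous_on (sphere 0 1) q"
    using span_continuous[OF cB] p q by auto
  define e where "e x = b x - q x" for x
  define w where "w x = u x - p x" for x
  have ce: "continuous_on (sphere 0 1) e" "continuous_on (sphere 0 1) w"
    unfolding e_def w_def using cb cp insert.prems(1) by (auto intro!: continuous_intros)
  \<comment> \<open>\<open>B\<close> may be dependent, so \<open>e\<close> may vanish on the sphere.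
    Then the quotient is 0 by convention, and the equation \<open>ew\<close> still holds because
    both sides are 0.\<close>
  define t where "t = sphere_inner e w / sphere_inner e e"
  have ew: "sphere_inner e w = t * sphere_inner e e"
  proof (cases "sphere_inner e e = 0")
    case True
    have "sphere_inner e w = sphere_integral (\<lambda>x::'a. 0)"
      unfolding sphere_inner_def
      by (rule sphere_integral_cong) (use sphere_inner_self_eq_0[OF ce(1) True] in auto)
    then show ?thesis using True by (simp add: sphere_integral_def)
  qed (simp add: t_def)
  define r where "r x = 1 * w x + (- t) * e x" for x
  have cr: "continuous_on (sphere 0 1) r" unfolding r_def by (intro continuous_intros ce)
  have rB: "sphere_inner c r = 0" if "c \<in> B" for c
  proof -
    have "sphere_inner c w = 0" "sphere_inner c e = 0"
      using p(2)[OF that] q(2)[OF that] by (simp_all add: w_def[abs_def] e_def[abs_def])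
    then show ?thesis
      unfolding r_def using sphere_inner_linear[OF cB[OF that] ce(2,1), of 1 "- t"] by simp
  qed
  have "sphere_inner e r = 0"
    unfolding r_def using sphere_inner_linear[OF ce(1) ce(2,1), of 1 "- t"] ew by simp
  \<comment> \<open>\<open>r\<close> is orthogonal to all of \<open>B\<close>, hence to
    \<open>q\<close>; being orthogonal to \<open>e\<close> as well, it is orthogonal to
    \<open>b\<close>, the sum of \<open>e\<close> and \<open>q\<close>.\<close>
  moreover have "sphere_inner r q = 0"
    by (rule sphere_inner_span[OF cr cB _ q(1)]) (use rB in \<open>simp_all add: sphere_inner_commute[of r]\<close>)
  moreover have "sphere_inner r b = sphere_inner r (\<lambda>x. 1 * e x + 1 * q x)" by (simp add: e_def)
  ultimately have "sphere_inner b r = 0"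
    using sphere_inner_linear[OF cr ce(1) cp(2), of 1 1] by (simp add: sphere_inner_commute)
  have "(\<lambda>x. p x + t * e x) \<in> fun_space.span (insert b B)"
  proof -
    have "p \<in> fun_space.span (insert b B)" "q \<in> fun_space.span (insert b B)" "b \<in> fun_space.span (insert b B)"
      using p(1) q(1) fun_space.span_mono[of B "insert b B"] fun_space.span_base[of b "insert b B"] by auto
    then have "p + (\<lambda>x. t * (b - q) x) \<in> fun_space.span (insert b B)"
      by (intro fun_space.span_add fun_space.span_scale fun_space.span_diff)
    moreover have "p + (\<lambda>x. t * (b - q) x) = (\<lambda>x. p x + t * e x)" by (simp add: fun_eq_iff e_def)
    ultimately show ?thesis by simp
  qed
  moreover have "(\<lambda>x. u x - (p x + t * e x)) = r" by (auto simp: r_def w_def)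
  ultimately show ?case using rB \<open>sphere_inner b r = 0\<close>
    by (intro bexI[of _ "\<lambda>x. p x + t * e x"]) auto
qed

text \<open>Splitting off the top degree repeatedly writes every polynomial as a sum of harmonics,
  so \<open>u\<close> is orthogonal to all polynomials.\<close>

lemma orthogonal_harmonics_eq_0:
  fixes u :: "'a::euclidean_space \<Rightarrow> real"
  assumes N: "DIM('a) \<ge> 2" and u: "u \<in> eigenspace \<mu>"
    and orth: "\<And>K e. e \<in> harmonics K \<Longrightarrow> sphere_inner u e = 0"
  shows "u = 0"
proof -
  note cu = eigenspace_continuous[OF u]
  have 0: "sphere_inner u p = 0" if "p \<in> sphere_poly K" for K p
    using that
  proof (induction K arbitrary: p)
    case 0
    then have "p = (\<lambda>x. 0)" by (rule sphere_poly_zero_degree)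
    then show ?case by (simp add: sphere_inner_def sphere_integral_def)
  next
    case (Suc K)
    obtain e z where ez: "e \<in> harmonics K" "z \<in> sphere_poly K" "p = e + z"
      using Suc.prems by (rule sphere_poly_Suc_decompose[OF N])
    have "p = (\<lambda>x. 1 * e x + 1 * z x)" using ez(3) by (simp add: plus_fun_def)
    moreover have "continuous_on (sphere 0 1) e"
      using ez(1) by (auto simp: harmonics_def intro: eigenspace_continuous)
    ultimately show ?case
      using sphere_inner_linear[OF cu _ sphere_poly_continuous[OF ez(2)], of e 1 1]
        orth[OF ez(1)] Suc.IH[OF ez(2)] by simp
  qed
  have "u x = 0" if "norm x = 1" for x
    by (rule orthogonal_polynomials_eq_0[OF cu _ that]) (rule 0)
  moreover have "u x = 0" if "norm x \<noteq> 1" for x using u that by (auto simp: eigenspace_def)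
  ultimately show ?thesis by (auto simp: fun_eq_iff)
qed

lemma eigenspace_eq_trivial:
  assumes N: "DIM('a::euclidean_space) \<ge> 2" and \<mu>: "\<And>K. \<mu> \<noteq> eigval DIM('a) K"
  shows "eigenspace \<mu> = {0 :: 'a \<Rightarrow> real}"
proof -
  have "u = 0" if u: "u \<in> eigenspace \<mu>" for u :: "'a \<Rightarrow> real"
    by (rule orthogonal_harmonics_eq_0[OF N u])
      (use eigenspace_orthogonal[OF u _ \<mu>] in \<open>auto simp: harmonics_def\<close>)
  then show ?thesis using fun_space.subspace_0[OF subspace_eigenspace] by auto
qed

text \<open>Let \<open>p\<close> be the projection of an eigenfunction \<open>u\<close> to the
  harmonics of degree \<open>K\<close>. Then \<open>u - p\<close> is again an eigenfunction,
  orthogonal to degree \<open>K\<close> by construction and to the other degrees because their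
  eigenvalues differ; so it is 0.\<close>

lemma eigenspace_eq_harmonics:
  assumes n: "n \<ge> 2" "DIM('a::euclidean_space) = n + 1"
  shows "eigenspace (eigval DIM('a) K) = (harmonics K :: ('a \<Rightarrow> real) set)"
proof
  have N: "DIM('a) \<ge> 2" using n by simp
  show "(harmonics K :: ('a \<Rightarrow> real) set) \<subseteq> eigenspace (eigval DIM('a) K)" by (simp add: harmonics_def)
  show "eigenspace (eigval DIM('a) K) \<subseteq> (harmonics K :: ('a \<Rightarrow> real) set)"
  proof
    fix u :: "'a \<Rightarrow> real" assume u: "u \<in> eigenspace (eigval DIM('a) K)"
    obtain B :: "('a \<Rightarrow> real) set" where B: "fun_space.span B = harmonics K" "finite B"
      using harmonics_basis[OF n] by metis
    have hE: "h \<in> eigenspace (eigval DIM('a) K)" if "h \<in> harmonics K" for h :: "'a \<Rightarrow> real" and K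
      using that by (simp add: harmonics_def)
    have BH: "b \<in> harmonics K" if "b \<in> B" for b
      using fun_space.span_base[OF that] B(1) by simp
    have cB: "continuous_on (sphere 0 1) b" if "b \<in> B" for b
      using eigenspace_continuous[OF hE[OF BH[OF that]]] .
    obtain p where p: "p \<in> harmonics K" "\<And>b. b \<in> B \<Longrightarrow> sphere_inner b (\<lambda>x. u x - p x) = 0"
      using orthogonal_projection[OF B(2) eigenspace_continuous[OF u] cB] unfolding B(1) by blast
    have w: "u - p \<in> eigenspace (eigval DIM('a) K)"
      using fun_space.subspace_diff[OF subspace_eigenspace u hE[OF p(1)]] .
    note cw = eigenspace_continuous[OF w]
    have "u - p = 0"
    proof (rule orthogonal_harmonics_eq_0[OF N w])
      fix j and e :: "'a \<Rightarrow> real" assume e: "e \<in> harmonics j"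
      show "sphere_inner (u - p) e = 0"
      proof (cases "j = K")
        case True
        show ?thesis
        proof (rule sphere_inner_span[OF cw cB])
          fix b assume "b \<in> B"
          from p(2)[OF this] show "sphere_inner (u - p) b = 0"
            by (subst sphere_inner_commute) (simp add: fun_diff_def)
        qed (use e True B in auto)
      next
        case False
        show ?thesis
          by (rule eigenspace_orthogonal[OF w hE[OF e]]) (use eigval_eq_iff[OF N] False in auto)
      qed
    qed
    then show "u \<in> harmonics K" using p(1) by simp
  qed
qed

section \<open>Chains of orders and uniqueness of the eigenvalue sequence\<close>

lemma chain_mult_pos:
  assumes "n \<ge> 2" shows "chain_mult n K > 0"
proof -
  have "((n + K - 2) choose n) \<le> ((n + K - 1) choose n)" by (rule binomial_right_mono) simp
  moreover have "(n + K) choose n = ((n + K - 1) choose n) + ((n + K - 1) choose (n - 1))"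
    using assms binomial_Suc_Suc[of "n + K - 1" "n - 1"] by simp
  moreover have "((n + K - 1) choose (n - 1)) > 0" by (simp add: zero_less_binomial)
  ultimately show ?thesis unfolding chain_mult_def by linarith
qed

lemma chain_sum_Suc: "chain_sum n (Suc K) = chain_sum n K + chain_mult n K"
  by (simp add: chain_sum_def)

lemma strict_mono_chain_sum: "n \<ge> 2 \<Longrightarrow> strict_mono (chain_sum n)"
  by (rule strict_monoI_Suc) (simp add: chain_sum_Suc chain_mult_pos)

text \<open>The number of the chain that contains the order \<open>k\<close>.\<close>

definition chain_index :: "nat \<Rightarrow> nat \<Rightarrow> nat" where
  "chain_index n k = (LEAST K. k < chain_sum n (Suc K))"

lemma chain_index_iff:
  assumes n: "n \<ge> 2"
  shows "chain_index n k = K \<longleftrightarrow> chain_sum n K \<le> k \<and> k < chain_sum n (Suc K)"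
proof -
  have mono: "chain_sum n i \<le> chain_sum n j" if "i \<le> j" for i j
    using strict_mono_mono[OF strict_mono_chain_sum[OF n]] that by (auto dest: monoD)
  have 1: "k < chain_sum n (Suc k)"
    using strict_mono_imp_increasing[OF strict_mono_chain_sum[OF n], of "Suc k"] by simp
  have b: "k < chain_sum n (Suc (chain_index n k))"
    unfolding chain_index_def using 1 by (rule LeastI)
  have a: "chain_sum n (chain_index n k) \<le> k"
  proof (cases "chain_index n k")
    case (Suc j)
    then have "\<not> k < chain_sum n (Suc j)"
      unfolding chain_index_def by (intro not_less_Least) simp
    then show ?thesis using Suc by simp
  qed (simp add: chain_sum_def)
  show ?thesis
  proof
    assume c: "chain_sum n K \<le> k \<and> k < chain_sum n (Suc K)"
    then have "\<not> Suc (chain_index n k) \<le> K" using mono[of "Suc (chain_index n k)" K] b by auto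
    moreover have "\<not> Suc K \<le> chain_index n k" using mono[of "Suc K" "chain_index n k"] a c by auto
    ultimately show "chain_index n k = K" by simp
  qed (use a b in auto)
qed

lemma mono_chain_index:
  assumes n: "n \<ge> 2" and "k \<le> k'" shows "chain_index n k \<le> chain_index n k'"
proof -
  have "k' < chain_sum n (Suc (chain_index n k'))" using chain_index_iff[OF n] by blast
  then show ?thesis
    unfolding chain_index_def[of n k] using assms(2) by (intro Least_le) simp
qed

lemma initial_segment:
  fixes A :: "nat set"
  assumes "finite A" "\<And>x y. x \<in> A \<Longrightarrow> y < x \<Longrightarrow> y \<in> A"
  shows "A = {..<card A}"
proof (cases "A = {}")
  case False
  have "A = {..Max A}"
  proof (intro equalityI subsetI)
    fix y assume "y \<in> {..Max A}"
    then show "y \<in> A" using assms(2)[OF Max_in[OF assms(1) False], of y] Max_in[OF assms(1) False]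
      by (cases "y = Max A") auto
  qed (use assms(1) in auto)
  then show ?thesis by (metis card_atMost lessThan_Suc_atMost)
qed simp

lemma eigenvalue_sequence_exists:
  assumes n: "n \<ge> 2" "DIM('a::euclidean_space) = n + 1"
  shows "is_eigenvalue_sequence TYPE('a) (\<lambda>k. eigval (n + 1) (chain_index n k))"
proof -
  let ?l = "\<lambda>k. eigval (n + 1) (chain_index n k)"
  have N: "n + 1 \<ge> 2" using n by simp
  have "mono ?l"
  proof (rule monoI)
    fix i j :: nat assume "i \<le> j"
    then have "chain_index n i \<le> chain_index n j" by (rule mono_chain_index[OF n(1)])
    then show "?l i \<le> ?l j"
      using eigval_strict_mono[OF N, of "chain_index n i" "chain_index n j"] by (cases "chain_index n i = chain_index n j") auto
  qed
  moreover have "\<exists>B :: ('a \<Rightarrow> real) set. fun_space.independent B \<and> fun_space.span B = eigenspace \<mu> \<and>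
      (\<exists>f. bij_betw f {k. ?l k = \<mu>} B)" for \<mu>
  proof (cases "\<exists>K. \<mu> = eigval (n + 1) K")
    case True
    then obtain K where K: "\<mu> = eigval (n + 1) K" ..
    obtain B :: "('a \<Rightarrow> real) set" where B: "fun_space.independent B" "fun_space.span B = harmonics K"
      "finite B" "card B = chain_mult n K"
      using harmonics_basis[OF n] by metis
    have "{k. ?l k = \<mu>} = {chain_sum n K..<chain_sum n (Suc K)}"
      using chain_index_iff[OF n(1)] by (auto simp: K eigval_eq_iff[OF N, simplified])
    then have "finite {k. ?l k = \<mu>}" "card {k. ?l k = \<mu>} = card B"
      using B by (auto simp: chain_sum_Suc)
    with B(3) have "\<exists>f. bij_betw f {k. ?l k = \<mu>} B" by (intro finite_same_card_bij)
    moreover have "eigenspace \<mu> = (harmonics K :: ('a \<Rightarrow> real) set)"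
      using eigenspace_eq_harmonics[OF n, of K] by (simp add: K n)
    ultimately show ?thesis using B by (intro exI[of _ B]) simp
  next
    case False
    then have "eigenspace \<mu> = {0 :: 'a \<Rightarrow> real}"
      by (intro eigenspace_eq_trivial) (use n in auto)
    moreover have "{k. ?l k = \<mu>} = {}" using False by auto
    ultimately show ?thesis
      by (intro exI[of _ "{}"]) (simp add: fun_space.independent_empty bij_betw_def)
  qed
  ultimately show ?thesis by (simp add: is_eigenvalue_sequence_def)
qed

text \<open>For a monotone \<open>l\<close> the orders with value below
  \<open>eigval (n + 1) K\<close> form an initial segment. Its length is the sum of the
  multiplicities below \<open>K\<close>, which locates every order in its chain.\<close>

lemma eigenvalue_sequence_unique:
  assumes n: "n \<ge> 2" "DIM('a::euclidean_space) = n + 1"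
    and l: "is_eigenvalue_sequence TYPE('a) l"
  shows "l k = eigval (n + 1) (chain_index n k)"
proof -
  have N: "n + 1 \<ge> 2" using n by simp
  let ?F = "\<lambda>K. {k. l k = eigval (n + 1) K}"
  have mono: "mono l" using l by (simp add: is_eigenvalue_sequence_def)
  have ex: "\<exists>B :: ('a \<Rightarrow> real) set. fun_space.independent B \<and> fun_space.span B = eigenspace \<mu> \<and>
      (\<exists>f. bij_betw f {k. l k = \<mu>} B)" for \<mu>
    using l by (simp add: is_eigenvalue_sequence_def)
  have F: "finite (?F K) \<and> card (?F K) = chain_mult n K" for K
  proof -
    obtain B' :: "('a \<Rightarrow> real) set" and f where B': "fun_space.independent B'"
      "fun_space.span B' = eigenspace (eigval (n + 1) K)" and f: "bij_betw f (?F K) B'"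
      using ex by blast
    obtain B :: "('a \<Rightarrow> real) set" where B: "fun_space.independent B" "fun_space.span B = harmonics K"
      "finite B" "card B = chain_mult n K"
      using harmonics_basis[OF n] by metis
    have "fun_space.span B' = fun_space.span B"
      using eigenspace_eq_harmonics[OF n, of K] by (simp add: n B B')
    from fun_space.bij_if_span_eq_span_bases[OF B'(1) B(1) this]
    obtain g where "bij_betw g B' B" by blast
    with f have "bij_betw (g \<circ> f) (?F K) B" by (rule bij_betw_trans)
    then show ?thesis using B(3,4) bij_betw_finite bij_betw_same_card by metis
  qed
  \<comment> \<open>A value outside the list has the zero eigenspace, whose basis is empty, although
    it would have to match a set of orders containing \<open>k\<close>.\<close>
  have range: "\<exists>K. l k = eigval (n + 1) K" for k
  proof (rule ccontr)
    assume no: "\<nexists>K. l k = eigval (n + 1) K"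
    obtain B :: "('a \<Rightarrow> real) set" and f where B: "fun_space.independent B"
      "fun_space.span B = eigenspace (l k)" and f: "bij_betw f {j. l j = l k} B"
      using ex by blast
    have "eigenspace (l k) = {0 :: 'a \<Rightarrow> real}"
      by (rule eigenspace_eq_trivial) (use n no in auto)
    then have "B \<subseteq> {0}" using fun_space.span_superset[of B] B(2) by simp
    moreover have "0 \<notin> B" using B(1) fun_space.dependent_zero by blast
    ultimately have "B = {}" by auto
    then have "{j. l j = l k} = {}" using f by (auto simp: bij_betw_def)
    then show False by auto
  qed
  have seg: "{k. l k < eigval (n + 1) K} = {..<chain_sum n K}" for K
  proof -
    have "{k. l k < eigval (n + 1) K} = (\<Union>j<K. ?F j)"
    proof (intro equalityI subsetI)
      fix i assume i: "i \<in> {k. l k < eigval (n + 1) K}"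
      obtain j where j: "l i = eigval (n + 1) j" using range by blast
      then have "j < K"
        using i eigval_strict_mono[OF N, of K j] by (cases j K rule: linorder_cases) auto
      with j show "i \<in> (\<Union>j<K. ?F j)" by auto
    qed (use eigval_strict_mono[OF N] in auto)
    moreover have "card (\<Union>j<K. ?F j) = chain_sum n K"
      unfolding chain_sum_def using F eigval_eq_iff[OF N] by (subst card_UN_disjoint) auto
    moreover have "finite (\<Union>j<K. ?F j)" using F by auto
    moreover have "y \<in> {k. l k < eigval (n + 1) K}"
      if "x \<in> {k. l k < eigval (n + 1) K}" "y < x" for x y
      using monoD[OF mono, of y x] that by simp
    ultimately show ?thesis using initial_segment[of "{k. l k < eigval (n + 1) K}"] by simp
  qed
  define K where "K = chain_index n k"
  have K: "chain_sum n K \<le> k" "k < chain_sum n (Suc K)"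
    using chain_index_iff[OF n(1), of k K] by (auto simp: K_def)
  obtain j where j: "l k = eigval (n + 1) j" using range by blast
  have "k \<in> {k. l k < eigval (n + 1) (Suc K)}" "k \<notin> {k. l k < eigval (n + 1) K}"
    unfolding seg using K by auto
  then have "l k < eigval (n + 1) (Suc K)" "\<not> l k < eigval (n + 1) K" by auto
  then have "j = K" unfolding j
    using eigval_strict_mono[OF N, of j K] eigval_strict_mono[OF N, of "Suc K" j]
    by (cases j "Suc K" rule: linorder_cases) (auto simp: less_Suc_eq)
  then show ?thesis by (simp add: j K_def)
qed

lemma sphere_eigenvalue_eq:
  assumes n: "n \<ge> 2" "DIM('a::euclidean_space) = n + 1"
  shows "sphere_eigenvalue TYPE('a) = (\<lambda>k. eigval (n + 1) (chain_index n k))"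
  unfolding sphere_eigenvalue_def
proof (rule the_equality)
  fix l assume "is_eigenvalue_sequence TYPE('a) l"
  then show "l = (\<lambda>k. eigval (n + 1) (chain_index n k))"
    by (intro ext eigenvalue_sequence_unique[OF n])
qed (rule eigenvalue_sequence_exists[OF n])

section \<open>Weyl constant and eigenvalue bounds\<close>

lemma infdist_sphere: "infdist x (sphere (0::'a::euclidean_space) 1) = \<bar>norm x - 1\<bar>"
proof (rule antisym)
  obtain b :: 'a where b: "norm b = 1" using vector_choose_size[of 1] by auto
  define y where "y = (if x = 0 then b else sgn x)"
  have y: "y \<in> sphere 0 1" using b by (simp add: y_def norm_sgn)
  have "dist x y = \<bar>norm x - 1\<bar>"
  proof (cases "x = 0")
    case False
    have "x - sgn x = (norm x - 1) *\<^sub>R sgn x"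
      using inner_sgn_self[OF False] by (simp add: algebra_simps)
    then show ?thesis using False by (simp add: y_def dist_norm norm_sgn)
  qed (use b in \<open>simp add: y_def\<close>)
  then show "infdist x (sphere 0 1) \<le> \<bar>norm x - 1\<bar>" using infdist_le[OF y, of x] by simp
  have ne: "sphere (0::'a) 1 \<noteq> {}" using y by blast
  show "\<bar>norm x - 1\<bar> \<le> infdist x (sphere 0 1)"
    unfolding infdist_notempty[OF ne]
  proof (rule cINF_greatest[OF ne])
    fix y :: 'a assume "y \<in> sphere 0 1"
    then show "\<bar>norm x - 1\<bar> \<le> dist x y"
      using norm_triangle_ineq3[of x y] by (simp add: dist_norm)
  qed
qed

text \<open>The neighbourhood is a shell of volume V ((1 + e)^N - (1 - e)^N), with V the volume of
  the unit ball; divided by 2 e it tends to half the derivative at 0, which is N V.\<close>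

lemma hypersurface_volume_sphere:
  "hypersurface_volume (sphere (0::'a::euclidean_space) 1) = real DIM('a) * unit_ball_vol (real DIM('a))"
proof -
  let ?N = "DIM('a)" let ?V = "unit_ball_vol (real ?N)"
  have m: "measure lebesgue {x::'a. infdist x (sphere 0 1) \<le> e} = ?V * (1 + e) ^ ?N - ?V * (1 - e) ^ ?N"
    if e: "0 < e" "e < 1" for e
  proof -
    have "{x::'a. infdist x (sphere 0 1) \<le> e} = cball 0 (1 + e) - ball 0 (1 - e)"
      by (auto simp: infdist_sphere)
    then have "measure lebesgue {x::'a. infdist x (sphere 0 1) \<le> e} =
        measure lebesgue (cball (0::'a) (1 + e)) - measure lebesgue (ball (0::'a) (1 - e))"
      using e by (simp add: measurable_measure_Diff lmeasurable_cball lmeasurable_ball subset_iff)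
    then show ?thesis using e by (simp add: content_cball content_ball)
  qed
  define g where "g e = ?V * (1 + e) ^ ?N - ?V * (1 - e) ^ ?N" for e :: real
  have "(g has_real_derivative 2 * (real ?N * ?V)) (at 0)"
    unfolding g_def by (auto intro!: derivative_eq_intros)
  then have "((\<lambda>h. g h / h) \<longlongrightarrow> 2 * (real ?N * ?V)) (at 0)"
    by (simp add: DERIV_def g_def)
  then have "((\<lambda>h. g h / h / 2) \<longlongrightarrow> 2 * (real ?N * ?V) / 2) (at_right 0)"
    by (intro tendsto_divide tendsto_const) (auto intro: filterlim_at_withinI tendsto_mono[OF at_le])
  moreover have "eventually (\<lambda>e. g e / e / 2 = measure lebesgue {x::'a. infdist x (sphere 0 1) \<le> e} / (2 * e)) (at_right 0)"
    by (rule eventually_at_rightI[of 0 1]) (auto simp: m g_def)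
  ultimately have "((\<lambda>e. measure lebesgue {x::'a. infdist x (sphere 0 1) \<le> e} / (2 * e)) \<longlongrightarrow> real ?N * ?V) (at_right 0)"
    by (simp add: tendsto_cong)
  then show ?thesis unfolding hypersurface_volume_def by (rule tendsto_Lim[rotated]) simp
qed

text \<open>The recursion from dimension n to n + 2 has the factor 2 pi / (n + 2), so the product of
  neighbouring volumes satisfies a one-step recursion and no Gamma values at half-integers
  remain.\<close>

lemma unit_ball_vol_mult_Suc:
  "unit_ball_vol (real n) * unit_ball_vol (real (Suc n)) = 2 * (2 * pi) ^ n / fact (Suc n)"
proof (induction n)
  case (Suc n)
  have "unit_ball_vol (real (Suc (Suc n))) = unit_ball_vol (real n) * (2 * pi / (real n + 2))"
  proof -
    have "Gamma (real n / 2 + 1 + 1) = (real n / 2 + 1) * Gamma (real n / 2 + 1)"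
      by (rule Gamma_plus1) (auto dest!: nonpos_Ints_nonpos)
    moreover have "pi powr (real n / 2 + 1) = pi powr (real n / 2) * pi" by (simp add: powr_add)
    moreover have "real (Suc (Suc n)) / 2 = real n / 2 + 1" by simp
    ultimately have "unit_ball_vol (real (Suc (Suc n))) = pi powr (real n / 2) * pi / ((real n / 2 + 1) * Gamma (real n / 2 + 1))"
      by (simp only: unit_ball_vol_def)
    then show ?thesis by (simp add: unit_ball_vol_def field_simps)
  qed
  then have "unit_ball_vol (real (Suc n)) * unit_ball_vol (real (Suc (Suc n))) =
      (unit_ball_vol (real n) * unit_ball_vol (real (Suc n))) * (2 * pi / (real n + 2))"
    by simp
  also have "\<dots> = 2 * (2 * pi) ^ Suc n / fact (Suc (Suc n))"
    unfolding Suc.IH by (simp add: field_simps)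
  finally show ?case .
qed (simp add: unit_ball_vol_0 unit_ball_vol_1)

lemma weyl_constant_sphere:
  assumes n: "n \<ge> 2" "DIM('a::euclidean_space) = n + 1"
  shows "weyl_constant n (hypersurface_volume (sphere (0 :: 'a) 1)) = (fact n / 2) powr (2 / real n)"
proof -
  have "unit_ball_vol (real n) * hypersurface_volume (sphere (0 :: 'a) 1) =
      real (Suc n) * (unit_ball_vol (real n) * unit_ball_vol (real (Suc n)))"
    by (simp add: hypersurface_volume_sphere n add.commute)
  also have "\<dots> = (2 * pi) ^ n / (fact n / 2)"
    unfolding unit_ball_vol_mult_Suc by simp
  finally have "weyl_constant n (hypersurface_volume (sphere (0 :: 'a) 1)) =
      4 * pi\<^sup>2 / (((2 * pi) ^ n) powr (2 / real n) / (fact n / 2) powr (2 / real n))"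
    unfolding weyl_constant_def by (subst powr_divide[symmetric]) auto
  also have "((2 * pi) ^ n) powr (2 / real n) = (2 * pi) powr (real n * (2 / real n))"
    by (subst powr_realpow[symmetric]) (simp_all add: powr_powr)
  also have "\<dots> = 4 * pi\<^sup>2" using n by (simp add: power_mult_distrib)
  finally show ?thesis by simp
qed

section \<open>Estimates for the lowest order of a chain\<close>

text \<open>Both binomials contain the rising factorial K (K + 1) ... (K + n - 2); the factors left
  over, K + n - 1 and K - 1, add up to 2 K + n - 2.\<close>

lemma chain_sum_product:
  assumes n: "n \<ge> 2"
  shows "fact n / 2 * real (chain_sum n K) = pochhammer (real K) (n - 1) * (real K + real n / 2 - 1)"
proof -
  obtain m where m: "n = Suc m" using n by (cases n) auto
  have poch: "real (N choose n) = pochhammer (real N - real n + 1) n / fact n" for N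
    by (rule trans[OF binomial_gbinomial gbinomial_pochhammer'])
  have "real (n + K - 1) - real n + 1 = real K" "real (n + K - 2) - real n + 1 = real K - 1"
    using n by (simp_all add: of_nat_diff)
  then have b: "real ((n + K - 1) choose n) = pochhammer (real K) n / fact n"
    and b': "real ((n + K - 2) choose n) = pochhammer (real K - 1) n / fact n"
    by (simp_all only: poch)
  have "real (chain_sum n K) = (pochhammer (real K) n + pochhammer (real K - 1) n) / fact n"
    unfolding chain_sum_eq[OF n] of_nat_add b b' by (rule add_divide_distrib[symmetric])
  also have "pochhammer (real K) n + pochhammer (real K - 1) n = pochhammer (real K) m * (2 * real K + real n - 2)"
    using pochhammer_Suc[of "real K" m] pochhammer_rec[of "real K - 1" m] by (simp add: m algebra_simps)
  finally have "fact n * real (chain_sum n K) = pochhammer (real K) m * (2 * real K + real n - 2)"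
    by simp
  moreover have "n - 1 = m" using m by simp
  ultimately show ?thesis by (simp only:) (simp add: algebra_simps)
qed

text \<open>Squaring multiplies each factor by its mirror image, which avoids a distinction by the
  parity of \<open>m\<close>.\<close>

lemma pochhammer_square_bounds:
  fixes K m :: nat
  defines "s \<equiv> real K + (real m - 1) / 2"
  assumes m: "m \<ge> 1"
  shows "(real K * (real K + real m - 1)) ^ m \<le> (pochhammer (real K) m)\<^sup>2"
    and "(pochhammer (real K) m)\<^sup>2 \<le> (s\<^sup>2) ^ m"
proof -
  have "(\<Prod>j<m. real K + real (m - Suc j)) = (\<Prod>j<m. real K + real j)"
    by (rule prod.nat_diff_reindex[of "\<lambda>j. real K + real j"])
  then have "(pochhammer (real K) m)\<^sup>2 = (\<Prod>j<m. real K + real j) * (\<Prod>j<m. real K + real (m - Suc j))"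
    by (simp only: pochhammer_prod power2_eq_square atLeast0LessThan)
  also have "\<dots> = (\<Prod>j<m. (real K + real j) * (real K + real (m - Suc j)))"
    by (simp add: prod.distrib)
  finally have sq: "(pochhammer (real K) m)\<^sup>2 = (\<Prod>j<m. (real K + real j) * (real K + real (m - Suc j)))" .
  \<comment> \<open>Two forms of the paired product: the first adds a nonnegative term to the
    outermost pair and gives the lower bound, the second subtracts a square from the midpoint
    squared and gives the upper bound.\<close>
  have f: "(real K + real j) * (real K + real (m - Suc j)) = real K * (real K + real m - 1) + real j * real (m - Suc j)"
    "(real K + real j) * (real K + real (m - Suc j)) = s\<^sup>2 - ((real m - 1) / 2 - real j)\<^sup>2" if "j < m" for j
    using that by (simp_all add: s_def of_nat_diff field_simps power2_eq_square)
  have 0: "real K * (real K + real m - 1) \<ge> 0" using m by simp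
  have "(\<Prod>j<m. real K * (real K + real m - 1)) \<le> (pochhammer (real K) m)\<^sup>2"
    unfolding sq by (rule prod_mono) (use 0 f(1) in auto)
  then show "(real K * (real K + real m - 1)) ^ m \<le> (pochhammer (real K) m)\<^sup>2" by simp
  have "(pochhammer (real K) m)\<^sup>2 \<le> (\<Prod>j<m. s\<^sup>2)"
    unfolding sq
  proof (rule prod_mono)
    fix j assume "j \<in> {..<m}"
    then have "(real K + real j) * (real K + real (m - Suc j)) \<le> s\<^sup>2"
      using f(2)[of j] by (simp only: lessThan_iff) simp
    then show "0 \<le> (real K + real j) * (real K + real (m - Suc j)) \<and>
        (real K + real j) * (real K + real (m - Suc j)) \<le> s\<^sup>2"
      by simp
  qed
  then show "(pochhammer (real K) m)\<^sup>2 \<le> (s\<^sup>2) ^ m" by simp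
qed

lemma power_le_imp_le:
  fixes a b :: real
  assumes "a ^ n \<le> b ^ n" "0 \<le> b" "n > 0" shows "a \<le> b"
  using assms by (metis gr0_implies_Suc power_le_imp_le_base)

text \<open>The quantity sqrt C times the n-th root of t, arranged so that its n-th power is a
  multiple of t and can be compared with products of integers.\<close>

definition weyl_radius :: "nat \<Rightarrow> real \<Rightarrow> real" where
  "weyl_radius n t = (fact n / 2 * t) powr (1 / real n)"

lemma weyl_radius_nonneg: "weyl_radius n t \<ge> 0"
  by (simp add: weyl_radius_def)

lemma weyl_radius_power: "n > 0 \<Longrightarrow> t \<ge> 0 \<Longrightarrow> weyl_radius n t ^ n = fact n / 2 * t"
proof -
  assume n: "n > 0" and t: "t \<ge> 0"
  have "(x powr (1 / real n)) ^ n = x" if "x > 0" for x :: real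
    using that n powr_realpow[of "x powr (1 / real n)" n] by (simp add: powr_powr)
  then show "weyl_radius n t ^ n = fact n / 2 * t"
    using n t unfolding weyl_radius_def by (cases "t = 0") auto
qed

lemma weyl_radius_mono: "0 \<le> s \<Longrightarrow> s \<le> t \<Longrightarrow> weyl_radius n s \<le> weyl_radius n t"
  unfolding weyl_radius_def by (intro powr_mono2) auto

lemma weyl_radius_eq:
  assumes "C = (fact n / 2) powr (2 / real n)" "t \<ge> 0"
  shows "sqrt C * t powr (1 / real n) = weyl_radius n t"
    and "C * t powr (2 / real n) = (weyl_radius n t)\<^sup>2"
proof -
  have "sqrt C = (fact n / 2) powr (1 / real n)"
    unfolding assms(1) by (simp add: powr_half_sqrt[symmetric] powr_powr)
  then show 1: "sqrt C * t powr (1 / real n) = weyl_radius n t"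
    unfolding weyl_radius_def using assms(2) by (subst powr_mult) auto
  have "t powr (2 / real n) = (t powr (1 / real n))\<^sup>2"
    by (simp add: power2_eq_square powr_add[symmetric])
  moreover have "C = (sqrt C)\<^sup>2" unfolding assms(1) by simp
  ultimately show "C * t powr (2 / real n) = (weyl_radius n t)\<^sup>2"
    unfolding 1[symmetric] by (simp add: power_mult_distrib)
qed

text \<open>With \<open>m = n - 1\<close>, the extra factor \<open>s\<close> in the n-th power of
  \<open>x\<close> is the midpoint of the rising factorial. So the n-th power of x^2 is a product of
  n terms, each between \<open>K (K + n - 2)\<close> and \<open>s\<close> squared.\<close>

lemma weyl_radius_chain_sum:
  fixes n K :: nat
  defines "x \<equiv> weyl_radius n (real (chain_sum n K))"
  assumes n: "n \<ge> 2"
  shows "real K * (real K + real n - 2) \<le> x\<^sup>2" and "x\<^sup>2 \<le> (real K + real n / 2 - 1)\<^sup>2"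
    and "real K \<le> x" and "x \<le> real K + real n / 2 - 1"
proof -
  obtain m where m: "n = Suc m" "m \<ge> 1" using n by (cases n) auto
  define s where "s = real K + real n / 2 - 1"
  have s0: "s \<ge> 0" using n by (simp add: s_def)
  have x0: "x \<ge> 0" by (simp add: x_def weyl_radius_nonneg)
  have s: "s = real K + (real m - 1) / 2" by (simp add: s_def m field_simps)
  have "x ^ n = fact n / 2 * real (chain_sum n K)"
    unfolding x_def by (rule weyl_radius_power) (use n in auto)
  also have "\<dots> = pochhammer (real K) (n - 1) * s"
    unfolding s_def by (rule chain_sum_product[OF n])
  finally have xn: "x ^ n = pochhammer (real K) m * s" using m(1) by simp
  then have x2n: "(x\<^sup>2) ^ n = (pochhammer (real K) m)\<^sup>2 * s\<^sup>2"
    by (metis power_commutes power_mult power_mult_distrib mult.commute)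
  note b = pochhammer_square_bounds[of m K, folded s, OF m(2)]
  have Ks: "real K * (real K + real m - 1) \<le> s\<^sup>2"
  proof -
    have "s\<^sup>2 = real K * (real K + real m - 1) + ((real m - 1) / 2)\<^sup>2"
      unfolding s by (simp add: power2_eq_square field_simps)
    then show ?thesis by simp
  qed
  have K0: "real K * (real K + real m - 1) \<ge> 0" using m by simp
  have "(real K * (real K + real m - 1)) ^ n = (real K * (real K + real m - 1)) ^ m * (real K * (real K + real m - 1))"
    by (simp add: m)
  also have "\<dots> \<le> (x\<^sup>2) ^ n" unfolding x2n by (rule mult_mono[OF b(1) Ks]) (use K0 in auto)
  finally have "real K * (real K + real m - 1) \<le> x\<^sup>2"
    by (rule power_le_imp_le) (use n in auto)
  then show 1: "real K * (real K + real n - 2) \<le> x\<^sup>2" by (simp add: m)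
  have "(x\<^sup>2) ^ n \<le> (s\<^sup>2) ^ n" unfolding x2n using mult_right_mono[OF b(2), of "s\<^sup>2"] by (simp add: m mult.commute)
  then have "x\<^sup>2 \<le> s\<^sup>2" by (rule power_le_imp_le) (use n in auto)
  then show "x\<^sup>2 \<le> (real K + real n / 2 - 1)\<^sup>2" by (simp add: s_def)
  from power2_le_imp_le[OF \<open>x\<^sup>2 \<le> s\<^sup>2\<close> s0] show "x \<le> real K + real n / 2 - 1" by (simp add: s_def)
  have "(real K)\<^sup>2 \<le> real K * (real K + real n - 2)"
    using n unfolding power2_eq_square by (intro mult_left_mono) auto
  from power2_le_imp_le[OF order_trans[OF this 1] x0] show "real K \<le> x" .
qed

section \<open>Eigenvalue inequalities and their sharpness\<close>

lemma tendsto_shifted_ratio: "(\<lambda>K. (real K + a) / (real K + b)) \<longlonglongrightarrow> 1"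
proof -
  have top: "filterlim (\<lambda>K. real K + b) at_top sequentially"
    using filterlim_tendsto_add_at_top[OF tendsto_const filterlim_real_sequentially, of b]
    by (simp add: add.commute)
  then have inf: "filterlim (\<lambda>K. real K + b) at_infinity sequentially"
    by (rule filterlim_at_top_imp_at_infinity)
  have "(\<lambda>K. 1 + (a - b) / (real K + b)) \<longlonglongrightarrow> 1 + 0"
    by (intro tendsto_add tendsto_const tendsto_divide_0[OF tendsto_const inf])
  moreover have "eventually (\<lambda>K. 1 + (a - b) / (real K + b) = (real K + a) / (real K + b)) sequentially"
  proof -
    have "eventually (\<lambda>K. real K + b > 0) sequentially"
      using top by (simp add: filterlim_at_top_dense)
    then show ?thesis by eventually_elim (simp add: field_simps)
  qed
  ultimately show ?thesis by (simp add: tendsto_cong)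
qed

lemma eigval_le_weyl:
  assumes n: "n \<ge> 2" and k: "chain_sum n K \<le> k"
  shows "eigval (n + 1) K \<le> (weyl_radius n (real k))\<^sup>2 + weyl_radius n (real k)"
proof -
  let ?x = "weyl_radius n (real (chain_sum n K))"
  have "eigval (n + 1) K = real K * (real K + real n - 2) + real K"
    by (simp add: eigval_def algebra_simps)
  also have "\<dots> \<le> ?x\<^sup>2 + ?x" using weyl_radius_chain_sum[OF n, of K] by linarith
  also have "\<dots> \<le> (weyl_radius n (real k))\<^sup>2 + weyl_radius n (real k)"
    using k by (intro add_mono power_mono weyl_radius_mono weyl_radius_nonneg) auto
  finally show ?thesis .
qed

text \<open>Since k + 1 is at most the lowest order of the next chain, y \<le> s with s = K + n / 2,
  and t (t - 1) is increasing for t \<ge> 1. Now s (s - 1) is the eigenvalue plus n (n - 2) / 4,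
  which is at most ((n + 1) / 2)^2; the fraction is nonnegative because y > n.\<close>

lemma eigval_ge_weyl:
  fixes n k :: nat
  defines "y \<equiv> weyl_radius n (real k + 1)"
  assumes n: "n \<ge> 2" and k: "k < chain_sum n (Suc K)" and y: "y > real n"
  shows "eigval (n + 1) K \<ge> y\<^sup>2 - y - ((real n + 1) / 2)\<^sup>2 - (real n)\<^sup>2 / (y - real n)"
proof -
  define s where "s = real K + real n / 2"
  have "y \<le> weyl_radius n (real (chain_sum n (Suc K)))"
    unfolding y_def using k by (intro weyl_radius_mono) auto
  also have "\<dots> \<le> s" using weyl_radius_chain_sum(4)[OF n, of "Suc K"] by (simp add: s_def)
  finally have ys: "y \<le> s" .
  have "y * (y - 1) \<le> s * (s - 1)" using ys y n by (intro mult_mono) auto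
  moreover have "s * (s - 1) = eigval (n + 1) K + real n * (real n - 2) / 4"
    by (simp add: s_def eigval_def field_simps)
  moreover have "real n * (real n - 2) / 4 \<le> ((real n + 1) / 2)\<^sup>2"
    by (simp add: power2_eq_square field_simps)
  moreover have "(real n)\<^sup>2 / (y - real n) \<ge> 0" using y by simp
  moreover have "y\<^sup>2 - y = y * (y - 1)" by (simp add: power2_eq_square algebra_simps)
  ultimately show ?thesis by linarith
qed

lemma weyl_upper_sharp:
  assumes n: "n \<ge> 2"
  shows "(\<lambda>K. (eigval (n + 1) K - (weyl_radius n (real (chain_sum n K)))\<^sup>2) /
    weyl_radius n (real (chain_sum n K))) \<longlonglongrightarrow> 1"
proof (rule tendsto_sandwich[OF _ _ tendsto_shifted_ratio tendsto_const])
  let ?x = "\<lambda>K. weyl_radius n (real (chain_sum n K))"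
  \<comment> \<open>Minus the gap between \<open>(K + n / 2 - 1)\<close> squared and
    \<open>K (K + n - 2)\<close>. The numerator lies between \<open>K + a\<close> and
    \<open>?x K\<close>, which itself differs from \<open>K\<close> by a bounded amount.\<close>
  define a where "a = - (real n / 2 - 1)\<^sup>2"
  have lower: "real K + a \<le> eigval (n + 1) K - (?x K)\<^sup>2" for K
    using weyl_radius_chain_sum(2)[OF n, of K] unfolding a_def eigval_def
    by (simp add: power2_eq_square field_simps)
  have upper: "eigval (n + 1) K - (?x K)\<^sup>2 \<le> ?x K" for K
    using weyl_radius_chain_sum(1,3)[OF n, of K] unfolding eigval_def
    by (simp add: field_simps)
  \<comment> \<open>A nonnegative numerator \<open>K + a\<close> is required before the denominator
    may be replaced by its upper bound.\<close>
  have "eventually (\<lambda>K. real K > max 0 (- a)) sequentially"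
    using filterlim_real_sequentially unfolding filterlim_at_top_dense by (rule spec)
  then have ev: "eventually (\<lambda>K. real K > 0 \<and> real K + a \<ge> 0) sequentially"
    by eventually_elim auto
  then show "eventually (\<lambda>K. (real K + a) / (real K + (real n / 2 - 1)) \<le> (eigval (n + 1) K - (?x K)\<^sup>2) / ?x K) sequentially"
  proof eventually_elim
    case (elim K)
    have x: "?x K > 0" "?x K \<le> real K + (real n / 2 - 1)"
      using weyl_radius_chain_sum(3,4)[OF n, of K] elim by linarith+
    have "(real K + a) / (real K + (real n / 2 - 1)) \<le> (real K + a) / ?x K"
      using elim x by (intro divide_left_mono) (auto intro!: mult_pos_pos)
    also have "\<dots> \<le> (eigval (n + 1) K - (?x K)\<^sup>2) / ?x K"
      using lower[of K] x by (intro divide_right_mono) auto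
    finally show ?case .
  qed
  show "eventually (\<lambda>K. (eigval (n + 1) K - (?x K)\<^sup>2) / ?x K \<le> 1) sequentially"
    using ev
  proof eventually_elim
    case (elim K)
    have "?x K > 0" using weyl_radius_chain_sum(3)[OF n, of K] elim by linarith
    then show ?case using upper[of K] by simp
  qed
qed

text \<open>With y taken from the next chain, y^2 minus the eigenvalue lies between (K + 1) (K + n -
  1) - K (K + n - 1) = K + n - 1 and K + n^2 / 4. The former is at least y because y \<le> K + n /
  2.\<close>

lemma weyl_lower_sharp:
  assumes n: "n \<ge> 2"
  shows "(\<lambda>K. ((weyl_radius n (real (chain_sum n (Suc K))))\<^sup>2 - eigval (n + 1) K) /
    weyl_radius n (real (chain_sum n (Suc K)))) \<longlonglongrightarrow> 1"
proof (rule tendsto_sandwich[OF _ _ tendsto_const tendsto_shifted_ratio])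
  let ?y = "\<lambda>K. weyl_radius n (real (chain_sum n (Suc K)))"
  have y: "real K + 1 \<le> ?y K" "?y K \<le> real K + real n / 2" for K
    using weyl_radius_chain_sum(3,4)[OF n, of "Suc K"] by simp_all
  have lower: "real K + (real n - 1) \<le> (?y K)\<^sup>2 - eigval (n + 1) K" for K
    using weyl_radius_chain_sum(1)[OF n, of "Suc K"] unfolding eigval_def
    by (simp add: algebra_simps)
  have upper: "(?y K)\<^sup>2 - eigval (n + 1) K \<le> real K + (real n)\<^sup>2 / 4" for K
    using weyl_radius_chain_sum(2)[OF n, of "Suc K"] unfolding eigval_def
    by (simp add: power2_eq_square field_simps)
  have "1 \<le> ((?y K)\<^sup>2 - eigval (n + 1) K) / ?y K" for K
  proof -
    have "?y K \<le> (?y K)\<^sup>2 - eigval (n + 1) K" using y[of K] lower[of K] n by simp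
    then show ?thesis using y(1)[of K] by simp
  qed
  then show "eventually (\<lambda>K. 1 \<le> ((?y K)\<^sup>2 - eigval (n + 1) K) / ?y K) sequentially" by simp
  have "((?y K)\<^sup>2 - eigval (n + 1) K) / ?y K \<le> (real K + (real n)\<^sup>2 / 4) / (real K + 1)" for K
    using upper[of K] y(1)[of K] by (intro frac_le) auto
  then show "eventually (\<lambda>K. ((?y K)\<^sup>2 - eigval (n + 1) K) / ?y K \<le> (real K + (real n)\<^sup>2 / 4) / (real K + 1)) sequentially"
    by simp
qed

theorem theorem6:
  fixes n :: nat and C :: real and lam :: "nat \<Rightarrow> real"
  assumes "n \<ge> 2"
    and "DIM('a::euclidean_space) = n + 1"
    and "C = weyl_constant n (hypersurface_volume (sphere (0 :: 'a) 1))"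
    and "lam = sphere_eigenvalue TYPE('a)"
  shows "C = (fact n / 2) powr (2 / real n) \<and>
    (\<forall>k. lam k \<le> C * real k powr (2 / real n) + sqrt C * real k powr (1 / real n)) \<and>
    (\<forall>k. real k > 2 * real n ^ n / fact n - 1 \<longrightarrow>
       lam k \<ge> C * (real k + 1) powr (2 / real n) - sqrt C * (real k + 1) powr (1 / real n)
         - ((real n + 1) / 2)\<^sup>2
         - (real n)\<^sup>2 / (sqrt C * (real k + 1) powr (1 / real n) - real n)) \<and>
    ((\<lambda>K. (lam (k_minus n K) - C * real (k_minus n K) powr (2 / real n)) /
           (sqrt C * real (k_minus n K) powr (1 / real n))) \<longlonglongrightarrow> 1) \<and>
    ((\<lambda>K. (C * (real (k_plus n K) + 1) powr (2 / real n) - lam (k_plus n K)) /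
           (sqrt C * (real (k_plus n K) + 1) powr (1 / real n))) \<longlonglongrightarrow> 1)"
proof -
  note n = assms(1)
  have C: "C = (fact n / 2) powr (2 / real n)"
    using assms(3) weyl_constant_sphere[OF assms(1,2)] by simp
  have lam: "lam k = eigval (n + 1) (chain_index n k)" for k
    using assms(4) sphere_eigenvalue_eq[OF assms(1,2)] by simp
  have ci: "chain_sum n (chain_index n k) \<le> k" "k < chain_sum n (Suc (chain_index n k))" for k
    using chain_index_iff[OF n, of k "chain_index n k"] by auto
  have pos: "chain_sum n K < chain_sum n (Suc K)" for K
    using chain_mult_pos[OF n, of K] by (simp add: chain_sum_Suc)
  have "chain_index n (k_minus n K) = K" for K
    using pos[of K] by (simp add: k_minus_def chain_index_iff[OF n])
  then have minus: "lam (k_minus n K) = eigval (n + 1) K" for K by (simp add: lam)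
  have "chain_index n (k_plus n K) = K" for K
    using pos[of K] by (simp add: k_plus_def chain_index_iff[OF n])
  then have plus: "lam (k_plus n K) = eigval (n + 1) K" for K by (simp add: lam)
  \<comment> \<open>The truncated subtraction in \<open>k_plus\<close> is exact because the chain is
    nonempty.\<close>
  have kp: "real (k_plus n K) + 1 = real (chain_sum n (Suc K))" for K
    using pos[of K] by (simp add: k_plus_def of_nat_diff)
  have "lam k \<le> C * real k powr (2 / real n) + sqrt C * real k powr (1 / real n)" for k
    using eigval_le_weyl[OF n ci(1)] by (simp add: lam weyl_radius_eq[OF C])
  moreover have "lam k \<ge> C * (real k + 1) powr (2 / real n) - sqrt C * (real k + 1) powr (1 / real n)
         - ((real n + 1) / 2)\<^sup>2
         - (real n)\<^sup>2 / (sqrt C * (real k + 1) powr (1 / real n) - real n)"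
    if k: "real k > 2 * real n ^ n / fact n - 1" for k
  proof -
    \<comment> \<open>The threshold on \<open>k\<close> says precisely that the radius at k + 1
      exceeds \<open>n\<close>, that is, that the last denominator of the lower bound is
      positive.\<close>
    have "real n ^ n < fact n / 2 * (real k + 1)" using k by (simp add: field_simps)
    also have "\<dots> = weyl_radius n (real k + 1) ^ n" using n by (simp add: weyl_radius_power)
    finally have "real n < weyl_radius n (real k + 1)"
      by (rule power_less_imp_less_base) (rule weyl_radius_nonneg)
    from eigval_ge_weyl[OF n ci(2) this] show ?thesis
      by (simp add: lam weyl_radius_eq[OF C])
  qed
  moreover have "(\<lambda>K. (lam (k_minus n K) - C * real (k_minus n K) powr (2 / real n)) /
           (sqrt C * real (k_minus n K) powr (1 / real n))) \<longlonglongrightarrow> 1"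
    using weyl_upper_sharp[OF n] by (simp add: minus weyl_radius_eq[OF C]) (simp add: k_minus_def)
  moreover have "(\<lambda>K. (C * (real (k_plus n K) + 1) powr (2 / real n) - lam (k_plus n K)) /
           (sqrt C * (real (k_plus n K) + 1) powr (1 / real n))) \<longlonglongrightarrow> 1"
    using weyl_lower_sharp[OF n] by (simp add: plus kp weyl_radius_eq[OF C])
  ultimately show ?thesis using C by blast
qed

end
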